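(* Let $K$ be an admissible triangulation of the sphere $S^d$, let $L$ be a finite simplicial complex and $g\colon K\to L$ a simplicial map. Then the quotient map $$q\colon |L|\cup_{|g|}|B(K)|\longrightarrow |L\cup_g B(K)|$$ from the topological mapping cone of $|g|$ to the geometric realization of the simplicial mapping cone of $g$ is a homotopy equivalence.
   Context: $|\cdot|$ denotes geometric realization. An admissible triangulation $K$ of $S^d\subset\mathbb R^{d+1}$ is the boundary complex of the convex hull of a finite generic set of unit vectors (no $d+2$ of them on a common geodesic sphere) whose convex hull contains the origin in its interior. Simplicial ball $B(K)$: fix $\rho_{\mathrm{inner}}\in(0,1)$ and an orientation of the edges of $K$ having no directed cycle inside any facet, so that the vertices of each facet are totally ordered, compatibly on common faces. $B(K)$ is the geometric simplicial complex in $\mathbb R^{d+1}$ whose vertices are the vertices $v'$ of $K$ (outer vertices), their scaled copies $v=\rho_{\mathrm{inner}}v'$ (inner vertices), and the origin $0$. For each facet of $K$ with ordered vertices $v_0'<\dots<v_d'$, it contains the simplices $[v_k,\dots,v_d,v_0',\dots,v_k']$ for $0\le k\le d$ (staircase triangulation of a prism) and the simplex $[0,v_0,\dots,v_d]$, together with all faces. It triangulates a ball whose boundary is the outer layer $K$. $|L|\cup_{|g|}|B(K)|$ is the adjunction space gluing $|B(K)|$ to $|L|$ along the boundary $|K|$ via $|g|\colon|K|\to|L|$. The simplicial mapping cone $L\cup_gB(K)$ is the quotient simplicial complex of $L\sqcup B(K)$ by the relation $v'\sim g(v')$ for all outer vertices $v'$: its vertices are those of $L$, the inner vertices and the origin,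 and its simplices are the simplices of $L$ and the images of the simplices of $B(K)$ under the vertex identification. The map $q$ is the one induced by this vertex identification, affine on each simplex of $L$ and of $B(K)$. *)

theory Defs
  imports "HOL-Analysis.Analysis"
begin

text \<open>
  A simplicial complex is the set of its simplices, and a simplex is the finite nonempty set of
  its vertices.  A geometric simplicial complex is presented in the same way, its vertices being
  points of a Euclidean space and its cells being the convex hulls of its simplices.
\<close>

definition finite_simplicial_complex :: "'v set set \<Rightarrow> bool" where
  "finite_simplicial_complex L \<longleftrightarrow>
     finite L \<and>
     (\<forall>s\<in>L. finite s \<and> s \<noteq> {}) \<and>
     (\<forall>s\<in>L. \<forall>t. t \<subseteq> s \<and> t \<noteq> {} \<longrightarrow> t \<in> L)"

definition facets :: "'v set set \<Rightarrow> 'v set set" where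
  "facets C = {s \<in> C. \<forall>t\<in>C. s \<subseteq> t \<longrightarrow> t = s}"

definition simplicial_map :: "'v set set \<Rightarrow> 'w set set \<Rightarrow> ('v \<Rightarrow> 'w) \<Rightarrow> bool" where
  "simplicial_map K L g \<longleftrightarrow> (\<forall>s\<in>K. g ` s \<in> L)"

text \<open>
  The realization of an abstract complex consists of functions giving barycentric coordinates.
  It is topologized as a subspace of the product \<open>'v \<Rightarrow> real\<close>, which for finite complexes is the
  usual topology.
\<close>

definition realization :: "'v set set \<Rightarrow> ('v \<Rightarrow> real) set" where
  "realization C =
     {u. (\<forall>v. 0 \<le> u v) \<and> {v. u v \<noteq> 0} \<in> C \<and> (\<Sum>v | u v \<noteq> 0. u v) = 1}"

definition realization_space :: "'v set set \<Rightarrow> ('v \<Rightarrow> real) topology" where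
  "realization_space C = top_of_set (realization C)"

text \<open>The affine extension of a vertex map adds up the coordinates over each fibre.\<close>

definition realization_map :: "('v \<Rightarrow> 'w) \<Rightarrow> ('v \<Rightarrow> real) \<Rightarrow> ('w \<Rightarrow> real)" where
  "realization_map f u = (\<lambda>w. \<Sum>v | u v \<noteq> 0 \<and> f v = w. u v)"

text \<open>The realization of a geometric complex is its underlying polyhedron.\<close>

definition polyhedron_of :: "'a::euclidean_space set set \<Rightarrow> 'a set" where
  "polyhedron_of C = (\<Union>s\<in>C. convex hull s)"

text \<open>
  On a geometric simplicial complex every point of the polyhedron has exactly one system of
  barycentric coordinates supported on a simplex, because the cells are simplices that meet in
  common faces.
\<close>

definition barycentric_coords :: "'a::euclidean_space set set \<Rightarrow> 'a \<Rightarrow> ('a \<Rightarrow> real)" where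
  "barycentric_coords C x =
     (THE u. u \<in> realization C \<and> (\<Sum>v | u v \<noteq> 0. u v *\<^sub>R v) = x)"

definition polyhedron_map ::
    "'a::euclidean_space set set \<Rightarrow> ('a \<Rightarrow> 'w) \<Rightarrow> 'a \<Rightarrow> ('w \<Rightarrow> real)" where
  "polyhedron_map C f x = realization_map f (barycentric_coords C x)"

definition disjoint_sum_topology :: "'a topology \<Rightarrow> 'b topology \<Rightarrow> ('a + 'b) topology" where
  "disjoint_sum_topology X Y =
     topology (\<lambda>U. openin X (Inl -` U) \<and> openin Y (Inr -` U))"

lemma openin_disjoint_sum_topology:
  "openin (disjoint_sum_topology X Y) U \<longleftrightarrow> openin X (Inl -` U) \<and> openin Y (Inr -` U)"
proof -
  have "istopology (\<lambda>U. openin X (Inl -` U) \<and> openin Y (Inr -` U))"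
    unfolding istopology_def by (auto simp: vimage_Union)
  then show ?thesis
    by (simp add: disjoint_sum_topology_def topology_inverse')
qed

lemma topspace_disjoint_sum_topology [simp]:
  "topspace (disjoint_sum_topology X Y) = topspace X <+> topspace Y"
proof
  show "topspace (disjoint_sum_topology X Y) \<subseteq> topspace X <+> topspace Y"
  proof
    fix z assume z: "z \<in> topspace (disjoint_sum_topology X Y)"
    have "Inl -` topspace (disjoint_sum_topology X Y) \<subseteq> topspace X"
         "Inr -` topspace (disjoint_sum_topology X Y) \<subseteq> topspace Y"
      using openin_topspace[of "disjoint_sum_topology X Y"]
      unfolding openin_disjoint_sum_topology by (blast dest: openin_subset)+
    with z show "z \<in> topspace X <+> topspace Y"
      by (cases z) auto
  qed
  have "Inl -` (topspace X <+> topspace Y) = topspace X"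
       "Inr -` (topspace X <+> topspace Y) = topspace Y"
    by auto
  then show "topspace X <+> topspace Y \<subseteq> topspace (disjoint_sum_topology X Y)"
    by (intro openin_subset) (simp add: openin_disjoint_sum_topology)
qed

definition quotient_topology :: "'a topology \<Rightarrow> ('a \<times> 'a) set \<Rightarrow> 'a set topology" where
  "quotient_topology X r = topology (\<lambda>U. U \<subseteq> topspace X // r \<and> openin X (\<Union>U))"

lemma openin_quotient_topology:
  assumes "equiv UNIV r"
  shows "openin (quotient_topology X r) U \<longleftrightarrow> U \<subseteq> topspace X // r \<and> openin X (\<Union>U)"
proof -
  have disj: "A = B" if "A \<in> topspace X // r" "B \<in> topspace X // r" "x \<in> A" "x \<in> B" for A B x
  proof -
    have "A \<in> UNIV // r" "B \<in> UNIV // r"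
      using that(1,2) by (auto simp: quotient_def)
    from quotient_disj[OF assms this] that(3,4) show ?thesis by auto
  qed
  have "\<Union>(S \<inter> T) = \<Union>S \<inter> \<Union>T" if "S \<subseteq> topspace X // r" "T \<subseteq> topspace X // r" for S T
  proof
    show "\<Union>S \<inter> \<Union>T \<subseteq> \<Union>(S \<inter> T)"
    proof
      fix x assume "x \<in> \<Union>S \<inter> \<Union>T"
      then obtain A B where AB: "A \<in> S" "x \<in> A" "B \<in> T" "x \<in> B" by blast
      with that have "A = B" by (intro disj[of A B x]) auto
      with AB show "x \<in> \<Union>(S \<inter> T)" by blast
    qed
  qed blast
  moreover have "openin X (\<Union>(\<Union>\<K>))" if "\<forall>K\<in>\<K>. openin X (\<Union>K)" for \<K>
  proof -
    have "\<Union>(\<Union>\<K>) = \<Union>(Union ` \<K>)" by blast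
    with that show ?thesis by auto
  qed
  ultimately have "istopology (\<lambda>U. U \<subseteq> topspace X // r \<and> openin X (\<Union>U))"
    unfolding istopology_def
    by (intro conjI allI impI) (simp_all add: le_infI1 openin_Int Sup_le_iff)
  then show ?thesis
    by (simp add: quotient_topology_def topology_inverse')
qed

definition gluing_relation :: "'b set \<Rightarrow> ('b \<Rightarrow> 'a) \<Rightarrow> (('a + 'b) \<times> ('a + 'b)) set" where
  "gluing_relation A f =
     (let r = {(Inr a, Inl (f a)) | a. a \<in> A} in (r \<union> r\<inverse>)\<^sup>*)"

lemma equiv_gluing_relation: "equiv UNIV (gluing_relation A f)"
  unfolding gluing_relation_def Let_def
  by (intro equivI refl_rtrancl sym_rtrancl trans_rtrancl) (auto simp: sym_def)

definition adjunction_space ::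
    "'a topology \<Rightarrow> 'b topology \<Rightarrow> 'b set \<Rightarrow> ('b \<Rightarrow> 'a) \<Rightarrow> ('a + 'b) set topology" where
  "adjunction_space X Y A f =
     quotient_topology (disjoint_sum_topology X Y) (gluing_relation A f)"

definition homotopy_equivalence_map :: "'a topology \<Rightarrow> 'b topology \<Rightarrow> ('a \<Rightarrow> 'b) \<Rightarrow> bool" where
  "homotopy_equivalence_map X Y f \<longleftrightarrow>
     continuous_map X Y f \<and>
     (\<exists>g. continuous_map Y X g \<and>
          homotopic_with (\<lambda>x. True) X X (g \<circ> f) id \<and>
          homotopic_with (\<lambda>x. True) Y Y (f \<circ> g) id)"

text \<open>For unit vectors, \<open>arccos (c \<bullet> x)\<close> is the geodesic distance on the sphere.\<close>

definition geodesic_sphere :: "'a::euclidean_space \<Rightarrow> real \<Rightarrow> 'a set" where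
  "geodesic_sphere c r = {x \<in> sphere 0 1. arccos (c \<bullet> x) = r}"

definition generic_on_sphere :: "nat \<Rightarrow> 'a::euclidean_space set \<Rightarrow> bool" where
  "generic_on_sphere d V \<longleftrightarrow>
     (\<forall>T. T \<subseteq> V \<and> card T = d + 2 \<longrightarrow>
        \<not> (\<exists>c\<in>sphere 0 1. \<exists>r. T \<subseteq> geodesic_sphere c r))"

definition boundary_complex :: "'a::euclidean_space set \<Rightarrow> 'a set set" where
  "boundary_complex P =
     {{v. v extreme_point_of F} | F. F face_of P \<and> F \<noteq> {} \<and> F \<noteq> P}"

definition admissible_triangulation :: "nat \<Rightarrow> 'a::euclidean_space set set \<Rightarrow> bool" where
  "admissible_triangulation d K \<longleftrightarrow>
     DIM('a) = d + 1 \<and>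
     (\<exists>V. finite V \<and> V \<subseteq> sphere 0 1 \<and> generic_on_sphere d V \<and>
          0 \<in> interior (convex hull V) \<and> K = boundary_complex (convex hull V))"

text \<open>\<open>(u, v) \<in> R\<close> means that the edge \<open>{u, v}\<close> is directed from \<open>u\<close> to \<open>v\<close>.\<close>

definition facet_acyclic_orientation :: "'a set set \<Rightarrow> ('a \<times> 'a) set \<Rightarrow> bool" where
  "facet_acyclic_orientation K R \<longleftrightarrow>
     R \<subseteq> {(u, v). u \<noteq> v \<and> {u, v} \<in> K} \<and>
     (\<forall>u v. u \<noteq> v \<and> {u, v} \<in> K \<longrightarrow> ((u, v) \<in> R \<longleftrightarrow> (v, u) \<notin> R)) \<and>
     (\<forall>F\<in>facets K. acyclic (Restr R F))"

text \<open>
  On a facet \<open>F\<close> the relation \<open>R\<close> is a strict total order.  If \<open>w\<close> is its \<open>k\<close>-th vertex, then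
  \<open>prism_simplex \<rho> R F w\<close> is the staircase simplex spanned by the outer vertices of \<open>F\<close> up to
  position \<open>k\<close> and the inner vertices from position \<open>k\<close> on.
\<close>

definition prism_simplex ::
    "real \<Rightarrow> ('a \<times> 'a) set \<Rightarrow> 'a set \<Rightarrow> 'a \<Rightarrow> 'a::euclidean_space set" where
  "prism_simplex \<rho> R F w =
     (\<lambda>v. \<rho> *\<^sub>R v) ` {v \<in> F. (w, v) \<in> R\<^sup>=} \<union> {v \<in> F. (v, w) \<in> R\<^sup>=}"

definition simplicial_ball ::
    "real \<Rightarrow> ('a \<times> 'a) set \<Rightarrow> 'a set set \<Rightarrow> 'a::euclidean_space set set" where
  "simplicial_ball \<rho> R K =
     {t. t \<noteq> {} \<and>
         (\<exists>F\<in>facets K.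
            (\<exists>w\<in>F. t \<subseteq> prism_simplex \<rho> R F w) \<or> t \<subseteq> insert 0 ((\<lambda>v. \<rho> *\<^sub>R v) ` F))}"

text \<open>
  The vertices of the mapping cone are \<open>Inl v\<close> for the vertices \<open>v\<close> of \<open>L\<close>, and \<open>Inr v\<close> for the
  inner vertices \<open>v\<close> and the origin.
\<close>

definition cone_vertex :: "'a set set \<Rightarrow> ('a \<Rightarrow> 'v) \<Rightarrow> 'a \<Rightarrow> 'v + 'a" where
  "cone_vertex K g v = (if v \<in> \<Union>K then Inl (g v) else Inr v)"

definition simplicial_mapping_cone ::
    "'v set set \<Rightarrow> 'a set set \<Rightarrow> ('a \<Rightarrow> 'v) \<Rightarrow> 'a set set \<Rightarrow> ('v + 'a) set set" where
  "simplicial_mapping_cone L K g B = (\<lambda>s. Inl ` s) ` L \<union> (\<lambda>t. cone_vertex K g ` t) ` B"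

definition topological_mapping_cone ::
    "'v set set \<Rightarrow> 'a::euclidean_space set set \<Rightarrow> ('a \<Rightarrow> 'v) \<Rightarrow> 'a set set
       \<Rightarrow> (('v \<Rightarrow> real) + 'a) set topology" where
  "topological_mapping_cone L K g B =
     adjunction_space (realization_space L) (top_of_set (polyhedron_of B))
       (polyhedron_of K) (polyhedron_map K g)"

text \<open>
  The vertex identification, extended affinely to \<open>\<bar>L\<bar>\<close> and \<open>\<bar>B\<bar>\<close>, takes the same value on all
  members of an equivalence class of the adjunction space.
\<close>

definition cone_quotient_map ::
    "'a::euclidean_space set set \<Rightarrow> ('a \<Rightarrow> 'v) \<Rightarrow> 'a set set
       \<Rightarrow> (('v \<Rightarrow> real) + 'a) set \<Rightarrow> ('v + 'a \<Rightarrow> real)" where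
  "cone_quotient_map K g B c =
     the_elem (case_sum (realization_map Inl) (polyhedron_map B (cone_vertex K g)) ` c)"

end

theory Submission
  imports Defs
begin

text \<open>
  In the ball, and likewise in the simplicial mapping cone, the mass of a point is distributed over
  the origin, the inner vertices and the outer vertices (those of \<open>L\<close> in the mapping cone).  A flow
  decreases the mass \<open>a\<close> of the origin to \<open>max 0 ((1 + t) * a - t)\<close> at time \<open>t\<close>, and where the origin
  is exhausted it moves the mass \<open>t - (1 + t) * a\<close> from the inner to the outer vertices, emptying the
  inner vertices of a facet one after the other, the smallest first.  In this order the support
  stays inside a staircase simplex, and this remains true after the outer vertices have been
  identified by \<open>g\<close>.  So the flow exists on the ball and on the mapping cone, commutes with \<open>q\<close>, and
  fixes \<open>\<bar>L\<bar>\<close>; at time 1 it has pushed the prisms into \<open>\<bar>L\<bar>\<close>, while the points where the origin has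
  positive mass have unique preimages under \<open>q\<close>.  Therefore the flow at time 1 on the mapping cone
  factors through \<open>q\<close>, and the factor is a homotopy inverse of \<open>q\<close>.
\<close>

subsection \<open>A flow pushing the prisms to the outer layer\<close>

text \<open>The map \<open>q\<close> is not injective in general: prism simplices collapse, and
  simplices over different facets can become equal. A flow on the mapping cone can therefore not be
  defined by choosing preimages. Its formulas read only the masses of the origin and of the inner
  vertices, which \<open>q\<close> leaves intact, and outer masses enter linearly; this is why it
  commutes with \<open>q\<close>. The order of the motion is forced by the simplices. No simplex
  contains the origin together with an outer vertex, so the origin has to be exhausted first. A
  staircase simplex contains both copies of its pivot only, so pushing all inner vertices outward
  simultaneously would leave the complex. The ball is a polyhedron, and \<open>q\<close> is defined
  on it through barycentric coordinates. Their uniqueness and continuity have to be proved; this is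
  the purpose of the fan and of the radial coefficients.\<close>

lemma realization_eq_sum:
  assumes "finite W" and "\<Union>C \<subseteq> W"
  shows "realization C = {u. (\<forall>v. 0 \<le> u v) \<and> {v. u v \<noteq> 0} \<in> C \<and> sum u W = 1}"
proof -
  have "(\<Sum>v | u v \<noteq> 0. u v) = sum u W" if "{v. u v \<noteq> 0} \<in> C" for u :: "'a \<Rightarrow> real"
    using that assms by (intro sum.mono_neutral_left) auto
  then show ?thesis
    unfolding realization_def by auto
qed

lemma realization_map_eq_sum:
  assumes "finite W" and "{v. u v \<noteq> 0} \<subseteq> W"
  shows "realization_map f u w = (\<Sum>v | v \<in> W \<and> f v = w. u v)"
  unfolding realization_map_def using assms
  by (intro sum.mono_neutral_left) auto

text \<open>
  The common structure of the ball (\<open>inn v = \<rho> v\<close>, \<open>out v = v\<close>, \<open>N = K\<close>) and of the mapping cone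
  (\<open>out v = g v\<close>, \<open>N = L\<close>).  In the second case \<open>out\<close> need not be injective.
\<close>

locale layered_complex =
  fixes Fs :: "'a set set" and V :: "'a set" and R :: "('a \<times> 'a) set"
    and org :: 'w and inn out :: "'a \<Rightarrow> 'w" and C N :: "'w set set"
  assumes vertices: "V = \<Union>Fs"
    and finite_vertices: "finite V"
    and facet_nonempty: "F \<in> Fs \<Longrightarrow> F \<noteq> {}"
    and total_facet: "F \<in> Fs \<Longrightarrow> x \<in> F \<Longrightarrow> y \<in> F \<Longrightarrow> x \<noteq> y \<Longrightarrow> (x, y) \<in> R \<or> (y, x) \<in> R"
    and acyclic_facet: "F \<in> Fs \<Longrightarrow> acyclic (Restr R F)"
    and irrefl_R: "(x, x) \<notin> R"
    and inj_inn: "inj_on inn V"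
    and inn_neq_org: "v \<in> V \<Longrightarrow> inn v \<noteq> org"
    and out_neq_org: "v \<in> V \<Longrightarrow> out v \<noteq> org"
    and out_neq_inn: "v \<in> V \<Longrightarrow> v' \<in> V \<Longrightarrow> out v \<noteq> inn v'"
    and finite_complex: "finite (\<Union>C)"
    and simplex_cases: "s \<in> C \<Longrightarrow> s \<notin> N \<Longrightarrow>
      \<exists>F\<in>Fs. (\<exists>w\<in>F. s \<subseteq> inn ` {v \<in> F. (w, v) \<in> R\<^sup>=} \<union> out ` {v \<in> F. (v, w) \<in> R\<^sup>=}) \<or>
              s \<subseteq> insert org (inn ` F)"
    and prism_simplex_in: "F \<in> Fs \<Longrightarrow> w \<in> F \<Longrightarrow>
      s \<subseteq> inn ` {v \<in> F. (w, v) \<in> R\<^sup>=} \<union> out ` {v \<in> F. (v, w) \<in> R\<^sup>=} \<Longrightarrow> s \<noteq> {} \<Longrightarrow> s \<in> C"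
    and cone_simplex_in: "F \<in> Fs \<Longrightarrow> s \<subseteq> insert org (inn ` F) \<Longrightarrow> s \<noteq> {} \<Longrightarrow> s \<in> C"
    and base_subset: "N \<subseteq> C"
    and base_avoids: "s \<in> N \<Longrightarrow> org \<notin> s \<and> inn ` V \<inter> s = {}"
    and out_base: "F \<in> Fs \<Longrightarrow> T \<subseteq> F \<Longrightarrow> T \<noteq> {} \<Longrightarrow> out ` T \<in> N"
begin

text \<open>If \<open>u org\<close> is at least \<open>t / (1 + t)\<close>, the other coordinates
  are multiplied by \<open>1 + t\<close>; below this threshold the origin is exhausted and they are
  renormalised by \<open>1 / (1 - u org)\<close>. One \<open>max\<close> covers both cases and keeps
  the denominator at least \<open>1 / (1 + t)\<close>, hence away from 0 also at the apex.\<close>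

definition scale :: "real \<Rightarrow> ('w \<Rightarrow> real) \<Rightarrow> 'w \<Rightarrow> real" where
  "scale t u w =
     (if w = org then max 0 ((1 + t) * u org - t) else u w / max (1 - u org) (1 / (1 + t)))"

text \<open>
  The share of the inner vertex \<open>v\<close> when the mass \<open>m\<close> is taken from the inner vertices in increasing
  order.
\<close>

definition moved :: "real \<Rightarrow> ('w \<Rightarrow> real) \<Rightarrow> 'a \<Rightarrow> real" where
  "moved m u v = min (u (inn v)) (max 0 (m - (\<Sum>v' | v' \<in> V \<and> (v', v) \<in> R. u (inn v'))))"

text \<open>The second sum may have several terms because \<open>out\<close> may identify vertices;
  the first has at most one, \<open>inn\<close> being injective on \<open>V\<close>.\<close>

definition transfer :: "real \<Rightarrow> ('w \<Rightarrow> real) \<Rightarrow> 'w \<Rightarrow> real" where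
  "transfer m u w = u w - (\<Sum>v | v \<in> V \<and> inn v = w. moved m u v)
                        + (\<Sum>v | v \<in> V \<and> out v = w. moved m u v)"

text \<open>The map taking \<open>u org\<close> to \<open>s = (1 + t) * u org - t\<close> sends
  [0, 1] affinely onto [-t, 1]. The positive part of \<open>s\<close> is the mass left at the
  origin, the negative part is the mass pushed outward. So the apex stays fixed, mass is pushed only
  once the origin is empty, and a point without origin mass is subjected to the amount
  \<open>t\<close>, which at time 1 is everything.\<close>

definition flow :: "real \<Rightarrow> ('w \<Rightarrow> real) \<Rightarrow> 'w \<Rightarrow> real" where
  "flow t u = transfer (max 0 (t - (1 + t) * u org)) (scale t u)"

section \<open>Mass bookkeeping of a transfer\<close>

lemma realization_iff:
  "u \<in> realization C \<longleftrightarrow> (\<forall>v. 0 \<le> u v) \<and> {v. u v \<noteq> 0} \<in> C \<and> sum u (\<Union>C) = 1"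
  using realization_eq_sum[OF finite_complex order_refl] by simp

lemma inn_in: "v \<in> V \<Longrightarrow> inn v \<in> \<Union>C"
  using cone_simplex_in[of _ "{inn v}"] vertices by blast

lemma out_in: "v \<in> V \<Longrightarrow> out v \<in> \<Union>C"
  using out_base[of _ "{v}"] base_subset vertices by fastforce

lemma org_in: "Fs \<noteq> {} \<Longrightarrow> org \<in> \<Union>C"
  using cone_simplex_in[of _ "{org}"] by blast

lemma facet_subset: "F \<in> Fs \<Longrightarrow> F \<subseteq> V"
  using vertices by auto

lemma moved_bounds:
  assumes "\<And>w. 0 \<le> u w"
  shows "0 \<le> moved m u v" "moved m u v \<le> u (inn v)"
  using assms by (auto simp: moved_def)

lemma sum_inn_fiber: "v \<in> V \<Longrightarrow> (\<Sum>v' | v' \<in> V \<and> inn v' = inn v. f v') = f v"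
proof -
  assume v: "v \<in> V"
  then have "{v'. v' \<in> V \<and> inn v' = inn v} = {v}"
    using inj_inn by (auto dest: inj_onD)
  then show ?thesis by simp
qed

lemma transfer_inn: "v \<in> V \<Longrightarrow> transfer m u (inn v) = u (inn v) - moved m u v"
proof -
  assume v: "v \<in> V"
  have "{v'. v' \<in> V \<and> out v' = inn v} = {}"
    using out_neq_inn v by auto
  then show ?thesis
    unfolding transfer_def sum_inn_fiber[OF v] by (simp del: Collect_empty_eq)
qed

lemma transfer_not_inn:
  assumes "w \<notin> inn ` V"
  shows "transfer m u w = u w + (\<Sum>v | v \<in> V \<and> out v = w. moved m u v)"
proof -
  have "{v. v \<in> V \<and> inn v = w} = {}" using assms by auto
  then show ?thesis unfolding transfer_def by (simp del: Collect_empty_eq)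
qed

lemma transfer_nonneg:
  assumes "\<And>w. 0 \<le> u w"
  shows "0 \<le> transfer m u w"
proof (cases "w \<in> inn ` V")
  case True
  then obtain v where "v \<in> V" "w = inn v" by auto
  then show ?thesis using moved_bounds(2)[of u m v] assms by (simp add: transfer_inn)
next
  case False
  then show ?thesis using assms moved_bounds[of u]
    by (auto simp: transfer_not_inn intro!: add_nonneg_nonneg sum_nonneg)
qed

text \<open>Each share occurs once in a fibre of \<open>inn\<close> and once in a fibre of
  \<open>out\<close>, so the two corrections cancel in the total.\<close>

lemma sum_transfer: "sum (transfer m u) (\<Union>C) = sum u (\<Union>C)"
  unfolding transfer_def
  using finite_complex finite_vertices inn_in out_in
  by (simp add: sum.distrib sum_subtractf sum.group image_subset_iff)

lemma transfer_0: "(\<And>w. 0 \<le> u w) \<Longrightarrow> transfer 0 u = u"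
proof -
  assume u: "\<And>w. 0 \<le> u w"
  then have "0 \<le> (\<Sum>v' | v' \<in> V \<and> (v', v) \<in> R. u (inn v'))" for v
    by (intro sum_nonneg)
  with u have "moved 0 u v = 0" for v
    by (simp add: moved_def max_absorb1 min_absorb2)
  then show ?thesis by (auto simp: transfer_def)
qed

lemma transfer_no_inner:
  assumes "\<And>w. 0 \<le> u w" "\<And>v. v \<in> V \<Longrightarrow> u (inn v) = 0"
  shows "transfer m u = u"
proof -
  have "moved m u v = 0" if "v \<in> V" for v
    using moved_bounds[of u m v] assms that by simp
  then show ?thesis by (auto simp: transfer_def intro!: sum.neutral)
qed

section \<open>Facet orders and the support of a transfer\<close>

text \<open>\<open>R\<close> is only a set of directed edges. Inside a facet, a missing edge from
  \<open>x\<close> to \<open>z\<close> would be reversed by totality and would close a directed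
  cycle.\<close>

lemma facet_trans:
  assumes "F \<in> Fs" "x \<in> F" "y \<in> F" "z \<in> F" "(x, y) \<in> R" "(y, z) \<in> R"
  shows "(x, z) \<in> R"
proof (rule ccontr)
  assume n: "(x, z) \<notin> R"
  have "(x, y) \<in> Restr R F" "(y, z) \<in> Restr R F" using assms by auto
  then have xz: "(x, z) \<in> (Restr R F)\<^sup>+" by (meson trancl.simps)
  have "x \<noteq> z" using xz acyclic_facet[OF assms(1)] by (auto simp: acyclic_def)
  with total_facet[OF assms(1,2,4)] n assms have "(z, x) \<in> Restr R F" by auto
  with xz have "(x, x) \<in> (Restr R F)\<^sup>+" by (rule trancl_into_trancl)
  with acyclic_facet[OF assms(1)] show False by (auto simp: acyclic_def)
qed

lemma facet_asym: "F \<in> Fs \<Longrightarrow> x \<in> F \<Longrightarrow> y \<in> F \<Longrightarrow> (x, y) \<in> R \<Longrightarrow> (y, x) \<notin> R"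
  using facet_trans irrefl_R by blast

lemma finite_facet: "F \<in> Fs \<Longrightarrow> finite F"
  using finite_vertices facet_subset finite_subset by blast

lemma facet_max:
  assumes "F \<in> Fs" "S \<subseteq> F" "S \<noteq> {}"
  obtains w where "w \<in> S" "\<And>v. v \<in> S \<Longrightarrow> (v, w) \<in> R\<^sup>="
proof -
  have "finite (Restr R F)" using finite_facet[OF assms(1)] by auto
  then have "wf ((Restr R F)\<inverse>)"
    using acyclic_facet[OF assms(1)] by (simp add: finite_acyclic_wf_converse)
  then obtain w where w: "w \<in> S" "\<And>y. (y, w) \<in> (Restr R F)\<inverse> \<Longrightarrow> y \<notin> S"
    by (rule wfE_min'[OF _ assms(3)]) blast
  have "(v, w) \<in> R\<^sup>=" if "v \<in> S" for v
    using w that total_facet[OF assms(1), of v w] assms(2) by auto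
  with w that show thesis by blast
qed

lemma facet_min:
  assumes "F \<in> Fs"
  obtains w where "w \<in> F" "\<And>v. v \<in> F \<Longrightarrow> (w, v) \<in> R\<^sup>="
proof -
  have "finite (Restr R F)" using finite_facet[OF assms(1)] by auto
  then have "wf (Restr R F)"
    using acyclic_facet[OF assms(1)] by (simp add: finite_acyclic_wf)
  then obtain w where w: "w \<in> F" "\<And>y. (y, w) \<in> Restr R F \<Longrightarrow> y \<notin> F"
    by (rule wfE_min'[OF _ facet_nonempty[OF assms(1)]]) blast
  have "(w, v) \<in> R\<^sup>=" if "v \<in> F" for v
    using w(1) w(2)[of v] that total_facet[OF assms(1) that w(1)] by blast
  with w that show thesis by blast
qed

text \<open>The inner face of a cone simplex lies in the staircase simplex whose pivot is the least
  vertex of the facet. Hence cone simplices need no separate treatment once the origin is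
  absent.\<close>

lemma simplex_without_org:
  assumes "s \<in> C" "org \<notin> s" "s \<notin> N"
  obtains F w where "F \<in> Fs" "w \<in> F"
    "s \<subseteq> inn ` {v \<in> F. (w, v) \<in> R\<^sup>=} \<union> out ` {v \<in> F. (v, w) \<in> R\<^sup>=}"
proof -
  have *: "\<exists>w\<in>F. s \<subseteq> inn ` {v \<in> F. (w, v) \<in> R\<^sup>=} \<union> out ` {v \<in> F. (v, w) \<in> R\<^sup>=}"
    if F: "F \<in> Fs" "s \<subseteq> insert org (inn ` F)" for F
  proof -
    obtain w where "w \<in> F" "\<And>v. v \<in> F \<Longrightarrow> (w, v) \<in> R\<^sup>="
      using facet_min[OF F(1)] by blast
    then have "s \<subseteq> inn ` {v \<in> F. (w, v) \<in> R\<^sup>=}" using F(2) assms(2) by blast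
    with \<open>w \<in> F\<close> show ?thesis by blast
  qed
  from simplex_cases[OF assms(1,3)] obtain F where F: "F \<in> Fs"
    and "(\<exists>w\<in>F. s \<subseteq> inn ` {v \<in> F. (w, v) \<in> R\<^sup>=} \<union> out ` {v \<in> F. (v, w) \<in> R\<^sup>=}) \<or>
         s \<subseteq> insert org (inn ` F)"
    by (rule bexE)
  then have "\<exists>w\<in>F. s \<subseteq> inn ` {v \<in> F. (w, v) \<in> R\<^sup>=} \<union> out ` {v \<in> F. (v, w) \<in> R\<^sup>=}"
    by (elim disjE) (assumption, rule *[OF F])
  then show thesis by (rule bexE) (rule that[OF F])
qed

text \<open>The new pivot is the greatest vertex with a positive share. Inner vertices below it have
  been emptied, and outer mass arrives only at vertices up to it; this is the shape of the staircase
  simplex at the new pivot. If nothing moves, the old pivot serves.\<close>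

lemma transfer_support_prism:
  assumes u: "\<And>w. 0 \<le> u w" and F: "F \<in> Fs" "w \<in> F"
    and supp: "{x. u x \<noteq> 0} \<subseteq> inn ` {v \<in> F. (w, v) \<in> R\<^sup>=} \<union> out ` {v \<in> F. (v, w) \<in> R\<^sup>=}"
  obtains w' where "w' \<in> F"
    "{x. transfer m u x \<noteq> 0} \<subseteq> inn ` {v \<in> F. (w', v) \<in> R\<^sup>=} \<union> out ` {v \<in> F. (v, w') \<in> R\<^sup>=}"
proof -
  have FV: "F \<subseteq> V" using F facet_subset by simp
  \<comment> \<open>Outer vertices never coincide with inner ones and \<open>inn\<close> is
    injective, so inner mass still locates its vertex when \<open>out\<close> identifies
    vertices.\<close>
  have inn_supp: "v \<in> F \<and> (w, v) \<in> R\<^sup>=" if "v \<in> V" "u (inn v) \<noteq> 0" for v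
  proof -
    have "inn v \<in> inn ` {v \<in> F. (w, v) \<in> R\<^sup>=} \<union> out ` {v \<in> F. (v, w) \<in> R\<^sup>=}"
      using that supp by blast
    moreover have "inn v \<notin> out ` {v \<in> F. (v, w) \<in> R\<^sup>=}"
      using out_neq_inn that(1) FV by fastforce
    ultimately obtain v' where v': "v' \<in> F" "(w, v') \<in> R\<^sup>=" "inn v = inn v'" by blast
    then have "v = v'" using inj_onD[OF inj_inn] that(1) FV by blast
    with v' show ?thesis by simp
  qed
  define S where "S = {v \<in> V. moved m u v > 0}"
  have S_F: "v \<in> F \<and> (w, v) \<in> R\<^sup>=" if "v \<in> S" for v
    using that inn_supp moved_bounds[of u m v, OF u] by (force simp: S_def)
  have moved_0: "moved m u v = 0" if "v \<in> V" "v \<notin> S" for v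
    using that moved_bounds[of u m v, OF u] by (auto simp: S_def)
  show thesis
  proof (cases "S = {}")
    case True
    then have "transfer m u = u"
      using moved_0 by (auto simp: transfer_def intro!: sum.neutral)
    with supp F that show thesis by auto
  next
    case False
    then obtain w' where w': "w' \<in> S" "\<And>v. v \<in> S \<Longrightarrow> (v, w') \<in> R\<^sup>="
      using facet_max[OF F(1), of S] S_F by blast
    have w'F: "w' \<in> F" and ww': "(w, w') \<in> R\<^sup>=" using S_F w' by auto
    have pos: "(\<Sum>v' | v' \<in> V \<and> (v', w') \<in> R. u (inn v')) < m"
      using w'(1) by (auto simp: S_def moved_def)
    \<comment> \<open>A positive share at \<open>w'\<close> means that the mass below
      \<open>w'\<close> does not use up \<open>m\<close>. The mass below \<open>v\<close> together
      with that of \<open>v\<close> is part of the mass below \<open>w'\<close>, so the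
      \<open>min\<close> defining the share of \<open>v\<close> is its full inner mass.\<close>
    have lower: "moved m u v = u (inn v)" if v: "v \<in> F" "(v, w') \<in> R" for v
    proof -
      have fin: "finite {v' \<in> F. (v', x) \<in> R}" for x using finite_facet[OF F(1)] by simp
      \<comment> \<open>\<open>moved\<close> sums over predecessors in all of \<open>V\<close>, but
        transitivity is available only inside \<open>F\<close>; inner mass outside \<open>F\<close>
        vanishes.\<close>
      have eq: "(\<Sum>v' | v' \<in> V \<and> (v', x) \<in> R. u (inn v')) = (\<Sum>v' | v' \<in> F \<and> (v', x) \<in> R. u (inn v'))" for x
        using finite_vertices FV inn_supp by (intro sum.mono_neutral_right) auto
      have "(\<Sum>v' | v' \<in> F \<and> (v', v) \<in> R. u (inn v')) + u (inn v)
            = (\<Sum>v' \<in> insert v {v' \<in> F. (v', v) \<in> R}. u (inn v'))"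
        using fin irrefl_R by (subst sum.insert) auto
      also have "\<dots> \<le> (\<Sum>v' | v' \<in> F \<and> (v', w') \<in> R. u (inn v'))"
        using fin v u facet_trans[OF F(1) _ v(1) w'F _ v(2)] by (intro sum_mono2) auto
      finally have "u (inn v) \<le> m - (\<Sum>v' | v' \<in> V \<and> (v', v) \<in> R. u (inn v'))"
        using pos unfolding eq by linarith
      with u[of "inn v"] show ?thesis unfolding moved_def by auto
    qed
    have "{x. transfer m u x \<noteq> 0} \<subseteq> inn ` {v \<in> F. (w', v) \<in> R\<^sup>=} \<union> out ` {v \<in> F. (v, w') \<in> R\<^sup>=}"
    proof
      fix x assume "x \<in> {x. transfer m u x \<noteq> 0}"
      then have x: "transfer m u x \<noteq> 0" by simp
      show "x \<in> inn ` {v \<in> F. (w', v) \<in> R\<^sup>=} \<union> out ` {v \<in> F. (v, w') \<in> R\<^sup>=}"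
      proof (cases "x \<in> inn ` V")
        case True
        then obtain v where v: "v \<in> V" "x = inn v" by auto
        have ne: "u (inn v) \<noteq> moved m u v" using x transfer_inn v by auto
        then have "u (inn v) \<noteq> 0" using moved_bounds[of u m v, OF u] by auto
        then have "v \<in> F" using inn_supp v by auto
        with ne lower have "(v, w') \<notin> R" by auto
        with \<open>v \<in> F\<close> w'F total_facet[OF F(1)] v show ?thesis by blast
      next
        case False
        with x have "u x \<noteq> 0 \<or> (\<Sum>v | v \<in> V \<and> out v = x. moved m u v) \<noteq> 0"
          by (auto simp: transfer_not_inn)
        then show ?thesis
        proof
          assume "u x \<noteq> 0"
          with supp False FV have "x \<in> out ` {v \<in> F. (v, w) \<in> R\<^sup>=}" by blast
          moreover have "(v, w') \<in> R\<^sup>=" if "v \<in> F" "(v, w) \<in> R\<^sup>=" for v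
            using that ww' facet_trans[OF F(1) that(1) F(2) w'F] by auto
          ultimately show ?thesis by blast
        next
          assume "(\<Sum>v | v \<in> V \<and> out v = x. moved m u v) \<noteq> 0"
          then obtain v where "v \<in> V" "out v = x" "moved m u v \<noteq> 0"
            by (rule sum.not_neutral_contains_not_neutral) auto
          then have "v \<in> S" "out v = x" using moved_0 by auto
          with w'(2) S_F show ?thesis by blast
        qed
      qed
    qed
    with w'F that show thesis by blast
  qed
qed

lemma nonempty_support: "sum u A = (1::real) \<Longrightarrow> {v. u v \<noteq> 0} \<noteq> {}"
  by (metis (mono_tags) Collect_empty_eq sum.neutral zero_neq_one)

lemma transfer_in:
  assumes u: "u \<in> realization C" and "u org = 0"
  shows "transfer m u \<in> realization C"
proof -
  have nn: "\<And>w. 0 \<le> u w" and s1: "sum u (\<Union>C) = 1" and sC: "{v. u v \<noteq> 0} \<in> C"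
    using u by (auto simp: realization_iff)
  \<comment> \<open>Simplices of \<open>N\<close> need not be of staircase form, but they carry no
    inner mass, so nothing is moved there.\<close>
  have "{v. transfer m u v \<noteq> 0} \<in> C"
  proof (cases "{v. u v \<noteq> 0} \<in> N")
    case True
    then have "u (inn v) = 0" if "v \<in> V" for v
      using base_avoids that by blast
    then have "transfer m u = u" by (intro transfer_no_inner nn)
    with sC show ?thesis by simp
  next
    case False
    have "org \<notin> {v. u v \<noteq> 0}" using assms(2) by simp
    then obtain F w where F: "F \<in> Fs" "w \<in> F"
      "{x. u x \<noteq> 0} \<subseteq> inn ` {v \<in> F. (w, v) \<in> R\<^sup>=} \<union> out ` {v \<in> F. (v, w) \<in> R\<^sup>=}"
      by (rule simplex_without_org[OF sC _ False])
    obtain w' where "w' \<in> F"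
      "{x. transfer m u x \<noteq> 0} \<subseteq> inn ` {v \<in> F. (w', v) \<in> R\<^sup>=} \<union> out ` {v \<in> F. (v, w') \<in> R\<^sup>=}"
      using transfer_support_prism[OF nn F] by blast
    with F(1) show ?thesis
      using nonempty_support[of "transfer m u" "\<Union>C"] s1 sum_transfer
      by (intro prism_simplex_in) auto
  qed
  with nn s1 show ?thesis
    by (simp add: realization_iff sum_transfer transfer_nonneg)
qed

text \<open>Since the total mass is 1, the inner mass of a vertex and of its predecessors never
  exceeds the amount 1 to be moved, so no share is truncated. What remains lies on outer vertices of
  one facet, and these span a simplex of \<open>N\<close>.\<close>

lemma transfer_full:
  assumes u: "u \<in> realization C" and "u org = 0"
  shows "transfer 1 u \<in> realization N"
proof -
  have nn: "\<And>w. 0 \<le> u w" and s1: "sum u (\<Union>C) = 1" and sC: "{v. u v \<noteq> 0} \<in> C"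
    using u by (auto simp: realization_iff)
  have moved: "moved 1 u v = u (inn v)" if v: "v \<in> V" for v
  proof -
    have "(\<Sum>v' | v' \<in> V \<and> (v', v) \<in> R. u (inn v')) + u (inn v)
          = (\<Sum>v' \<in> insert v {v' \<in> V. (v', v) \<in> R}. u (inn v'))"
      using finite_vertices irrefl_R by (subst sum.insert) auto
    also have "\<dots> \<le> (\<Sum>v' \<in> V. u (inn v'))"
      using finite_vertices v nn by (intro sum_mono2) auto
    also have "\<dots> = sum u (inn ` V)"
      using inj_inn by (simp add: sum.reindex)
    also have "\<dots> \<le> sum u (\<Union>C)"
      using finite_complex inn_in nn by (intro sum_mono2) auto
    finally show ?thesis using nn[of "inn v"] s1 unfolding moved_def by auto
  qed
  have inn0: "transfer 1 u (inn v) = 0" if "v \<in> V" for v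
    using that transfer_inn moved by simp
  have ne: "{v. transfer 1 u v \<noteq> 0} \<noteq> {}"
    using nonempty_support s1 sum_transfer by metis
  have "{v. transfer 1 u v \<noteq> 0} \<in> N"
  proof (cases "{v. u v \<noteq> 0} \<in> N")
    case True
    then have "u (inn v) = 0" if "v \<in> V" for v
      using base_avoids that by blast
    then have "transfer 1 u = u" by (intro transfer_no_inner nn)
    with True show ?thesis by simp
  next
    case False
    have "org \<notin> {v. u v \<noteq> 0}" using assms(2) by simp
    then obtain F w where F: "F \<in> Fs" "w \<in> F"
      "{x. u x \<noteq> 0} \<subseteq> inn ` {v \<in> F. (w, v) \<in> R\<^sup>=} \<union> out ` {v \<in> F. (v, w) \<in> R\<^sup>=}"
      by (rule simplex_without_org[OF sC _ False])
    obtain w' where "w' \<in> F"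
      "{x. transfer 1 u x \<noteq> 0} \<subseteq> inn ` {v \<in> F. (w', v) \<in> R\<^sup>=} \<union> out ` {v \<in> F. (v, w') \<in> R\<^sup>=}"
      using transfer_support_prism[OF nn F] by blast
    then have "{x. transfer 1 u x \<noteq> 0} \<subseteq> out ` F"
      using inn0 facet_subset[OF F(1)] by (simp add: subset_iff) blast
    then obtain T where "T \<subseteq> F" "{x. transfer 1 u x \<noteq> 0} = out ` T"
      by (meson subset_image_iff)
    with ne F show ?thesis using out_base[of F T] by auto
  qed
  moreover have "\<Union>N \<subseteq> \<Union>C" using base_subset by auto
  ultimately show ?thesis
    using nn s1 by (simp add: realization_eq_sum[OF finite_complex] sum_transfer transfer_nonneg)
qed

section \<open>Scaling and the flow\<close>

lemma scale_id: "u org = 0 \<Longrightarrow> 0 \<le> t \<Longrightarrow> scale t u = u"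
  by (auto simp: scale_def max_def fun_eq_iff)

lemma scale_in:
  assumes u: "u \<in> realization C" and t: "0 \<le> t"
  shows "scale t u \<in> realization C"
proof (cases "u org = 0")
  \<comment> \<open>Without origin mass the point may lie outside all cone simplices, but then
    scaling does nothing.\<close>
  case True
  with u t show ?thesis by (simp add: scale_id)
next
  case False
  have nn: "\<And>w. 0 \<le> u w" and s1: "sum u (\<Union>C) = 1" and sC: "{v. u v \<noteq> 0} \<in> C"
    using u by (auto simp: realization_iff)
  have org: "org \<in> \<Union>C" using False sC by auto
  have lam: "0 < max (1 - u org) (1 / (1 + t))" using t by (simp add: less_max_iff_disj)
  have nn': "0 \<le> scale t u w" for w
    using nn lam by (auto simp: scale_def)
  have "sum (scale t u) (\<Union>C)
        = scale t u org + sum (scale t u) (\<Union>C - {org})"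
    using org finite_complex by (simp add: sum.remove del: Union_iff)
  also have "sum (scale t u) (\<Union>C - {org}) = sum u (\<Union>C - {org}) / max (1 - u org) (1 / (1 + t))"
    unfolding sum_divide_distrib by (intro sum.cong) (auto simp: scale_def)
  also have "sum u (\<Union>C - {org}) = 1 - u org"
    using org finite_complex s1 by (simp add: sum_diff1 del: Union_iff)
  \<comment> \<open>The cases are separated by \<open>u org = t / (1 + t)\<close>, where the two
    arguments of the \<open>max\<close> agree.\<close>
  also have "scale t u org + (1 - u org) / max (1 - u org) (1 / (1 + t)) = 1"
  proof (cases "(1 + t) * u org - t \<le> 0")
    case True
    then have "1 / (1 + t) \<le> 1 - u org"
      using t by (simp add: field_simps)
    moreover have "0 < 1 / (1 + t)" using t by simp
    ultimately have "max (1 - u org) (1 / (1 + t)) = 1 - u org" "1 - u org \<noteq> 0" by linarith+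
    then show ?thesis using True by (simp add: scale_def)
  next
    case False
    then have "1 - u org \<le> 1 / (1 + t)"
      using t by (simp add: field_simps)
    then have "max (1 - u org) (1 / (1 + t)) = 1 / (1 + t)" by simp
    with False t show ?thesis by (simp add: scale_def field_simps)
  qed
  finally have s1': "sum (scale t u) (\<Union>C) = 1" .
  \<comment> \<open>A support containing the origin lies neither in \<open>N\<close> nor in a
    staircase simplex, so only a cone simplex is left.\<close>
  have "{v. u v \<noteq> 0} \<notin> N" using base_avoids False by blast
  moreover have *: "\<not> {v. u v \<noteq> 0} \<subseteq> inn ` A \<union> out ` B" if "A \<subseteq> V" "B \<subseteq> V" for A B
    using False that inn_neq_org out_neq_org by blast
  then have "\<not> {v. u v \<noteq> 0} \<subseteq> inn ` {v \<in> F. P v} \<union> out ` {v \<in> F. Q v}" if "F \<in> Fs" for F P Q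
    using that facet_subset[of F] by (intro *) auto
  ultimately obtain F where F: "F \<in> Fs" "{v. u v \<noteq> 0} \<subseteq> insert org (inn ` F)"
    using simplex_cases[OF sC] by (auto simp del: reflcl_set_eq Un_iff)
  have "{v. scale t u v \<noteq> 0} \<subseteq> insert org (inn ` F)"
    using F(2) by (auto simp: scale_def split: if_splits)
  with F(1) have "{v. scale t u v \<noteq> 0} \<in> C"
    using nonempty_support s1' by (intro cone_simplex_in) auto
  with nn' s1' show ?thesis by (simp add: realization_iff)
qed

lemma flow_in:
  assumes u: "u \<in> realization C" and t: "0 \<le> t"
  shows "flow t u \<in> realization C"
proof (cases "(1 + t) * u org - t \<le> 0")
  case True
  then have "scale t u org = 0" by (simp add: scale_def)
  then show ?thesis unfolding flow_def by (intro transfer_in scale_in u t)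
next
  case False
  then have "flow t u = scale t u"
    using scale_in[OF u t] by (simp add: flow_def transfer_0 realization_iff)
  with scale_in[OF u t] show ?thesis by simp
qed

lemma flow_0:
  assumes u: "u \<in> realization C"
  shows "flow 0 u = u"
proof -
  have nn: "\<And>w. 0 \<le> u w" using u by (simp add: realization_iff)
  have "scale 0 u = u" using nn[of org] by (auto simp: scale_def fun_eq_iff max_def)
  then show ?thesis using nn by (simp add: flow_def transfer_0)
qed

lemma flow_base:
  assumes u: "u \<in> realization N" and t: "0 \<le> t"
  shows "flow t u = u"
proof -
  have nn: "\<And>w. 0 \<le> u w" and sN: "{v. u v \<noteq> 0} \<in> N"
    using u by (auto simp: realization_def)
  have "u org = 0" "\<And>v. v \<in> V \<Longrightarrow> u (inn v) = 0" using base_avoids[OF sN] by blast+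
  then show ?thesis
    unfolding flow_def using t nn by (simp add: scale_id transfer_no_inner)
qed

lemma flow_1_in_base: "u \<in> realization C \<Longrightarrow> u org = 0 \<Longrightarrow> flow 1 u \<in> realization N"
  by (simp add: flow_def scale_id transfer_full)

text \<open>Every coordinate is a closed expression in \<open>max\<close>, \<open>min\<close>,
  finite sums and a quotient with nonzero denominator. This yields continuity jointly in time and
  point, without pasting along the locus where the origin becomes empty.\<close>

lemma continuous_flow:
  "continuous_on ({0..1} \<times> S) (\<lambda>(t, u). flow t u)"
proof -
  have coord: "continuous_on A (\<lambda>p. snd p w :: real)" for A :: "(real \<times> ('w \<Rightarrow> real)) set" and w
    by (rule continuous_on_product_then_coordinatewise[OF continuous_on_snd[OF continuous_on_id]])
  have ne: "max (1 - snd p org) (1 / (1 + fst p)) \<noteq> 0"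
    if "p \<in> {0..1} \<times> S" for p :: "real \<times> ('w \<Rightarrow> real)"
    using that by (auto simp: max_def)
  have scale: "continuous_on ({0..1} \<times> S) (\<lambda>p. scale (fst p) (snd p) w)" for w
  proof (cases "w = org")
    case True
    then show ?thesis unfolding scale_def by (auto intro!: continuous_intros coord)
  next
    case False
    then show ?thesis unfolding scale_def using ne
      by (auto intro!: continuous_intros coord)
  qed
  have "continuous_on ({0..1} \<times> S) (\<lambda>p. flow (fst p) (snd p) w)" for w
    unfolding flow_def transfer_def moved_def
    by (intro continuous_intros scale coord)
  then show ?thesis
    by (intro continuous_on_coordinatewise_then_product) (simp add: case_prod_unfold)
qed

end

text \<open>The amounts that are moved depend only on the masses of the origin and the inner
  vertices, and \<open>f\<close> leaves these unchanged because their fibres in the vertex set are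
  single points. All remaining operations are linear in the outer masses, so they commute with
  summation over the fibres of \<open>f\<close>.\<close>

lemma realization_map_flow:
  assumes A: "layered_complex Fs V R org inn out C N"
    and B: "layered_complex Fs V R org' inn' out' C' N'"
    and ne: "Fs \<noteq> {}"
    and org: "\<And>w. w \<in> \<Union>C \<Longrightarrow> f w = org' \<longleftrightarrow> w = org"
    and inn: "\<And>v w. v \<in> V \<Longrightarrow> w \<in> \<Union>C \<Longrightarrow> f w = inn' v \<longleftrightarrow> w = inn v"
    and out: "\<And>v. v \<in> V \<Longrightarrow> f (out v) = out' v"
    and u: "u \<in> realization C" and t: "0 \<le> t"
  shows "realization_map f (layered_complex.flow V R org inn out t u) =
         layered_complex.flow V R org' inn' out' t (realization_map f u)"
proof -
  interpret A: layered_complex Fs V R org inn out C N by fact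
  interpret B: layered_complex Fs V R org' inn' out' C' N' by fact
  have supp: "{v. u v \<noteq> 0} \<subseteq> \<Union>C" if "u \<in> realization C" for u
    using that by (auto simp: realization_def)
  note map = realization_map_eq_sum[OF A.finite_complex supp]
  have single: "realization_map f u w' = u w"
    if "w \<in> \<Union>C" "\<And>x. x \<in> \<Union>C \<Longrightarrow> f x = w' \<longleftrightarrow> x = w" "u \<in> realization C" for u w w'
  proof -
    have "{x. x \<in> \<Union>C \<and> f x = w'} = {w}" using that by auto
    then show ?thesis using that(3) by (simp add: map)
  qed
  have f_org: "realization_map f u org' = u org" if "u \<in> realization C" for u
    using A.org_in[OF ne] org that by (intro single)
  have f_inn: "realization_map f u (inn' v) = u (inn v)" if "u \<in> realization C" "v \<in> V" for u v
    using A.inn_in inn that by (intro single)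
  have scale: "realization_map f (A.scale t u) = B.scale t (realization_map f u)"
  proof
    fix w'
    show "realization_map f (A.scale t u) w' = B.scale t (realization_map f u) w'"
    proof (cases "w' = org'")
      case True
      then show ?thesis
        using f_org[OF u] f_org[OF A.scale_in[OF u t]] by (simp add: A.scale_def B.scale_def)
    next
      case False
      then have "realization_map f (A.scale t u) w' =
          (\<Sum>v | v \<in> \<Union>C \<and> f v = w'. u v / max (1 - u org) (1 / (1 + t)))"
        unfolding map[OF A.scale_in[OF u t]] using org by (intro sum.cong) (auto simp: A.scale_def)
      with False show ?thesis
        using f_org[OF u] map[OF u, of f w'] by (simp add: B.scale_def sum_divide_distrib)
    qed
  qed
  have transfer: "realization_map f (A.transfer m u) = B.transfer m (realization_map f u)"
    if u: "u \<in> realization C" and m: "A.transfer m u \<in> realization C" for m u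
  proof
    fix w'
    have moved: "B.moved m (realization_map f u) v = A.moved m u v" if "v \<in> V" for v
      using that by (simp add: A.moved_def B.moved_def f_inn[OF u] cong: conj_cong)
    \<comment> \<open>The fibres of \<open>h\<close> over one fibre of \<open>f\<close> together
      make up a fibre of \<open>h'\<close>.\<close>
    have fiber: "(\<Sum>w | w \<in> \<Union>C \<and> f w = w'. \<Sum>v | v \<in> V \<and> h v = w. A.moved m u v)
        = (\<Sum>v | v \<in> V \<and> h' v = w'. B.moved m (realization_map f u) v)"
      if h: "\<And>v. v \<in> V \<Longrightarrow> h v \<in> \<Union>C \<and> f (h v) = h' v" for h h'
    proof -
      have "(\<Sum>w | w \<in> \<Union>C \<and> f w = w'. \<Sum>v | v \<in> V \<and> h v = w. A.moved m u v)
          = (\<Sum>w | w \<in> \<Union>C \<and> f w = w'. \<Sum>v | v \<in> {v \<in> V. h' v = w'} \<and> h v = w. A.moved m u v)"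
        using h by (intro sum.cong) auto
      also have "\<dots> = (\<Sum>v | v \<in> V \<and> h' v = w'. A.moved m u v)"
        using h finite_subset[OF _ A.finite_complex, of "{w. w \<in> \<Union>C \<and> f w = w'}"] A.finite_vertices
        by (intro sum.group) auto
      finally show ?thesis using moved by simp
    qed
    have "f (inn v) = inn' v" if "v \<in> V" for v using inn[OF that A.inn_in[OF that]] by simp
    then show "realization_map f (A.transfer m u) w' = B.transfer m (realization_map f u) w'"
      unfolding map[OF m] A.transfer_def B.transfer_def sum.distrib sum_subtractf
      using fiber[of inn inn'] fiber[of out out'] A.inn_in A.out_in out map[OF u, of f w'] by simp
  qed
  show ?thesis
    unfolding A.flow_def B.flow_def f_org[OF u] scale[symmetric]
    using A.flow_in[OF u t] by (intro transfer A.scale_in[OF u t]) (simp add: A.flow_def)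
qed

subsection \<open>Geometric complexes and their barycentric coordinates\<close>

text \<open>The realization is a finite union of closed simplices. Since the vertex type may be
  infinite, each is viewed inside a product over the whole type, with coordinates off the simplex
  confined to 0, and Tychonoff's theorem applies.\<close>

lemma compact_realization:
  assumes fin: "finite (\<Union>C)"
    and sub: "\<And>s t. s \<in> C \<Longrightarrow> t \<subseteq> s \<Longrightarrow> t \<noteq> {} \<Longrightarrow> t \<in> C"
  shows "compact (realization C)"
proof -
  define D where "D s = {u. (\<forall>v. u v \<in> (if v \<in> s then {0..1} else {0})) \<and> sum u s = (1::real)}"
    for s :: "'a set"
  have fins: "finite s" if "s \<in> C" for s
    using fin that by (meson Union_upper finite_subset)
  have "realization C = (\<Union>s\<in>C. D s)"
  proof (intro equalityI subsetI)
    fix u assume u: "u \<in> realization C"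
    then have sum1: "sum u {v. u v \<noteq> 0} = 1" and nn: "\<And>v. 0 \<le> u v" and s: "{v. u v \<noteq> 0} \<in> C"
      by (auto simp: realization_def)
    have "u v \<le> 1" if "u v \<noteq> 0" for v
      using member_le_sum[of v "{v. u v \<noteq> 0}" u] fins[OF s] nn that sum1 by simp
    with sum1 nn have "u \<in> D {v. u v \<noteq> 0}" by (simp add: D_def)
    with s show "u \<in> (\<Union>s\<in>C. D s)" by (rule UN_I)
  next
    fix u assume "u \<in> (\<Union>s\<in>C. D s)"
    then obtain s where "s \<in> C" "u \<in> D s" by (rule UN_E)
    then have s: "s \<in> C" "\<And>v. u v \<in> (if v \<in> s then {0..1} else {0})" "sum u s = 1"
      by (simp_all add: D_def)
    have supp: "{v. u v \<noteq> 0} \<subseteq> s"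
    proof
      fix v assume "v \<in> {v. u v \<noteq> 0}"
      then show "v \<in> s" using s(2)[of v] by (cases "v \<in> s") auto
    qed
    then have "sum u {v. u v \<noteq> 0} = 1"
      using fins[OF s(1)] s(3) by (subst sum.mono_neutral_left[of s]) auto
    moreover from this have "{v. u v \<noteq> 0} \<noteq> {}" by (metis sum.empty zero_neq_one)
    moreover have "0 \<le> u v" for v using s(2)[of v] by (cases "v \<in> s") auto
    ultimately show "u \<in> realization C"
      using sub[OF s(1) supp] by (simp add: realization_def)
  qed
  moreover have "compact (D s)" if "s \<in> C" for s
  proof -
    have "compact (Pi\<^sub>E UNIV (\<lambda>v. if v \<in> s then {0..1::real} else {0}))"
      using compactin_PiE[of "\<lambda>_. euclidean" UNIV "\<lambda>v. if v \<in> s then {0..1::real} else {0}"]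
      by (simp add: euclidean_product_topology)
    moreover have "closed {u. sum u s = (1::real)}"
      by (intro closed_Collect_eq continuous_intros continuous_on_product_coordinates)
    moreover have "D s = Pi\<^sub>E UNIV (\<lambda>v. if v \<in> s then {0..1::real} else {0}) \<inter> {u. sum u s = 1}"
      by (simp add: D_def PiE_UNIV_domain Pi_def Collect_conj_eq)
    ultimately show ?thesis by (simp add: compact_Int_closed)
  qed
  moreover have "finite C" using fin by (rule finite_UnionD)
  ultimately show ?thesis by (simp add: compact_UN)
qed

definition barycenter :: "('a::euclidean_space \<Rightarrow> real) \<Rightarrow> 'a" where
  "barycenter u = (\<Sum>v | u v \<noteq> 0. u v *\<^sub>R v)"

lemma barycenter_eq_sum:
  assumes "finite W" and "{v. u v \<noteq> 0} \<subseteq> W"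
  shows "barycenter u = (\<Sum>v\<in>W. u v *\<^sub>R v)"
  unfolding barycenter_def using assms by (intro sum.mono_neutral_left) auto

text \<open>Injectivity of \<open>barycenter\<close> expresses at once that the vertices of a
  simplex are affinely independent and that the cells meet in common faces. It is exactly what gives
  the \<open>THE\<close> in \<open>barycentric_coords\<close> a unique witness.\<close>

locale geometric_complex =
  fixes C :: "'a::euclidean_space set set"
  assumes finite_points: "finite (\<Union>C)"
    and down_closed: "s \<in> C \<Longrightarrow> t \<subseteq> s \<Longrightarrow> t \<noteq> {} \<Longrightarrow> t \<in> C"
    and inj_barycenter: "inj_on barycenter (realization C)"
begin

lemma finite_simplex: "s \<in> C \<Longrightarrow> finite s"
  using finite_points by (meson Union_upper finite_subset)

lemma barycenter_image: "barycenter ` realization C = polyhedron_of C"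
proof (intro equalityI subsetI)
  fix x assume "x \<in> barycenter ` realization C"
  then obtain u where u: "u \<in> realization C" "x = barycenter u" by auto
  then have s: "{v. u v \<noteq> 0} \<in> C" by (simp add: realization_def)
  have "x \<in> convex hull {v. u v \<noteq> 0}"
    unfolding convex_hull_finite[OF finite_simplex[OF s]]
    using u by (auto simp: barycenter_def realization_def)
  with s show "x \<in> polyhedron_of C" by (auto simp: polyhedron_of_def)
next
  fix x assume "x \<in> polyhedron_of C"
  then obtain s where s: "s \<in> C" "x \<in> convex hull s" by (auto simp: polyhedron_of_def)
  then obtain u where u: "\<And>v. v \<in> s \<Longrightarrow> 0 \<le> u v" "sum u s = 1" "(\<Sum>v\<in>s. u v *\<^sub>R v) = x"
    unfolding convex_hull_finite[OF finite_simplex[OF s(1)]] by auto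
  define u' where "u' = (\<lambda>v. if v \<in> s then u v else 0)"
  have supp: "{v. u' v \<noteq> 0} \<subseteq> s" by (auto simp: u'_def)
  have sum': "sum u' s = 1" using u(2) by (simp add: u'_def)
  then have "{v. u' v \<noteq> 0} \<noteq> {}" by (metis (mono_tags) Collect_empty_eq sum.neutral zero_neq_one)
  with supp s have "{v. u' v \<noteq> 0} \<in> C" using down_closed by blast
  moreover have "sum u' {v. u' v \<noteq> 0} = 1"
    using sum' supp finite_simplex[OF s(1)] by (subst sum.mono_neutral_left[of s]) auto
  ultimately have "u' \<in> realization C"
    using u(1) by (auto simp: realization_def u'_def)
  moreover have "barycenter u' = x"
    unfolding barycenter_eq_sum[OF finite_simplex[OF s(1)] supp] u(3)[symmetric]
    by (intro sum.cong) (auto simp: u'_def)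
  ultimately show "x \<in> barycenter ` realization C" by blast
qed

lemma barycentric_coords_barycenter:
  "u \<in> realization C \<Longrightarrow> barycentric_coords C (barycenter u) = u"
  unfolding barycentric_coords_def barycenter_def[symmetric]
  by (rule the_equality) (auto dest: inj_onD[OF inj_barycenter])

lemma barycentric_coords_in: "x \<in> polyhedron_of C \<Longrightarrow> barycentric_coords C x \<in> realization C"
  and barycenter_barycentric_coords:
    "x \<in> polyhedron_of C \<Longrightarrow> barycenter (barycentric_coords C x) = x"
  unfolding barycenter_image[symmetric] by (auto simp: barycentric_coords_barycenter)

lemma continuous_barycenter: "continuous_on (realization C) barycenter"
proof -
  have "continuous_on (realization C) (\<lambda>u. \<Sum>v\<in>\<Union>C. u v *\<^sub>R v)"
    by (intro continuous_intros continuous_on_product_then_coordinatewise[OF continuous_on_id])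
  then show ?thesis
    by (rule continuous_on_eq)
       (auto simp: realization_def intro!: barycenter_eq_sum[OF finite_points, symmetric])
qed

text \<open>A continuous injection of a compact space into a Hausdorff space has a continuous
  inverse on its image.\<close>

lemma continuous_barycentric_coords: "continuous_on (polyhedron_of C) (barycentric_coords C)"
  unfolding barycenter_image[symmetric]
  using continuous_barycenter compact_realization[OF finite_points down_closed]
  by (rule continuous_on_inv) (simp_all add: barycentric_coords_barycenter)

end

subsection \<open>The fan of an admissible triangulation\<close>

text \<open>This retains what the embedding of the ball needs: the facets span simplicial cones from
  the origin, and \<open>facet_functional\<close> is the supporting hyperplane of a facet,
  normalised to the value 1.\<close>

locale simplicial_fan =
  fixes K :: "'a::euclidean_space set set"
  assumes finite_K: "finite K"
    and K_nonempty: "K \<noteq> {}"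
    and unit_vertices: "\<Union>K \<subseteq> sphere 0 1"
    and simplex_nonempty: "s \<in> K \<Longrightarrow> s \<noteq> {}"
    and face_closed: "s \<in> K \<Longrightarrow> t \<subseteq> s \<Longrightarrow> t \<noteq> {} \<Longrightarrow> t \<in> K"
    and facet_independent: "F \<in> facets K \<Longrightarrow> independent F"
    and facet_functional: "F \<in> facets K \<Longrightarrow>
      \<exists>a. (\<forall>v\<in>\<Union>K. a \<bullet> v \<le> 1) \<and> (\<forall>v\<in>\<Union>K. a \<bullet> v = 1 \<longleftrightarrow> v \<in> F)"
begin

lemma facet_in: "F \<in> facets K \<Longrightarrow> F \<in> K"
  by (simp add: facets_def)

lemma in_facet:
  assumes "s \<in> K"
  obtains F where "F \<in> facets K" "s \<subseteq> F"
proof -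
  from finite_has_maximal2[OF finite_K assms] obtain F
    where "F \<in> K" "s \<subseteq> F" "\<forall>b\<in>K. F \<subseteq> b \<longrightarrow> F = b" by auto
  then have "F \<in> facets K" by (auto simp: facets_def)
  with \<open>s \<subseteq> F\<close> that show thesis by blast
qed

lemma Union_facets: "\<Union>(facets K) = \<Union>K"
  using in_facet facet_in by blast

lemma finite_verts: "finite (\<Union>K)"
  using facet_independent finite_K finiteI_independent Union_facets
  by (metis finite_Union finite_subset facet_in subsetI)

text \<open>Evaluates the common point with the functional that equals 1 exactly on \<open>F\<close>.\<close>

lemma facet_sum:
  assumes F: "F \<in> facets K" "F' \<in> facets K"
    and c: "\<And>v. 0 \<le> c v" "{v. c v \<noteq> 0} \<subseteq> F"
    and c': "\<And>v. 0 \<le> c' v" "{v. c' v \<noteq> 0} \<subseteq> F'"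
    and eq: "(\<Sum>v\<in>\<Union>K. c v *\<^sub>R v) = (\<Sum>v\<in>\<Union>K. c' v *\<^sub>R v)"
  shows "sum c (\<Union>K) \<le> sum c' (\<Union>K)"
    and "sum c (\<Union>K) = sum c' (\<Union>K) \<Longrightarrow> {v. c' v \<noteq> 0} \<subseteq> F"
proof -
  obtain a where a: "\<And>v. v \<in> \<Union>K \<Longrightarrow> a \<bullet> v \<le> 1" "\<And>v. v \<in> \<Union>K \<Longrightarrow> a \<bullet> v = 1 \<longleftrightarrow> v \<in> F"
    using facet_functional[OF F(1)] by blast
  have "sum c (\<Union>K) = (\<Sum>v\<in>\<Union>K. c v * (a \<bullet> v))"
  proof (rule sum.cong)
    fix v assume "v \<in> \<Union>K"
    then show "c v = c v * (a \<bullet> v)" using a(2)[of v] c(2) by (cases "c v = 0") auto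
  qed simp
  also have "\<dots> = a \<bullet> (\<Sum>v\<in>\<Union>K. c v *\<^sub>R v)" by (simp add: inner_sum_right)
  also have "\<dots> = (\<Sum>v\<in>\<Union>K. c' v * (a \<bullet> v))" by (simp add: eq inner_sum_right)
  finally have *: "sum c (\<Union>K) = (\<Sum>v\<in>\<Union>K. c' v * (a \<bullet> v))" .
  have le: "c' v * (a \<bullet> v) \<le> c' v" if "v \<in> \<Union>K" for v
    using mult_left_mono[OF a(1)[OF that] c'(1)[of v]] by simp
  then show "sum c (\<Union>K) \<le> sum c' (\<Union>K)" unfolding * by (rule sum_mono)
  assume "sum c (\<Union>K) = sum c' (\<Union>K)"
  \<comment> \<open>Equality of the sums forces equality in every term, so the functional equals 1
    wherever \<open>c'\<close> is nonzero.\<close>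
  then have "(\<Sum>v\<in>\<Union>K. c' v - c' v * (a \<bullet> v)) = 0" using * by (simp add: sum_subtractf)
  then have eq0: "c' v - c' v * (a \<bullet> v) = 0" if "v \<in> \<Union>K" for v
    using that le finite_verts by (subst (asm) sum_nonneg_eq_0_iff) auto
  show "{v. c' v \<noteq> 0} \<subseteq> F"
  proof
    fix v assume v: "v \<in> {v. c' v \<noteq> 0}"
    then have "v \<in> \<Union>K" using c'(2) F(2) facet_in by auto
    with eq0[OF this] a(2)[OF this] v show "v \<in> F" by simp
  qed
qed

text \<open>Using \<open>facet_sum\<close> in both directions makes the two totals equal. Then both
  supports lie in \<open>F\<close>, where linear independence decides.\<close>

lemma cone_unique:
  assumes F: "F \<in> facets K" "F' \<in> facets K"
    and c: "\<And>v. 0 \<le> c v" "{v. c v \<noteq> 0} \<subseteq> F"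
    and c': "\<And>v. 0 \<le> c' v" "{v. c' v \<noteq> 0} \<subseteq> F'"
    and eq: "(\<Sum>v\<in>\<Union>K. c v *\<^sub>R v) = (\<Sum>v\<in>\<Union>K. c' v *\<^sub>R v)"
  shows "c = c'"
proof
  fix v
  have "{v. c' v \<noteq> 0} \<subseteq> F"
    using facet_sum[OF F c c' eq] facet_sum(1)[OF F(2,1) c' c eq[symmetric]] by simp
  have F_K: "F \<subseteq> \<Union>K" and finF: "finite F"
    using facet_in[OF F(1)] finite_verts by (auto intro: finite_subset)
  have res: "(\<Sum>v\<in>\<Union>K. b v *\<^sub>R v) = (\<Sum>v\<in>F. b v *\<^sub>R v)" if "{v. b v \<noteq> 0} \<subseteq> F" for b
    using F_K finite_verts that by (intro sum.mono_neutral_right) auto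
  have "(\<Sum>v\<in>F. (c v - c' v) *\<^sub>R v) = 0"
    using eq res[OF c(2)] res[OF \<open>{v. c' v \<noteq> 0} \<subseteq> F\<close>]
    by (simp add: scaleR_diff_left sum_subtractf)
  then have "c v - c' v = 0" if "v \<in> F"
    using facet_independent[OF F(1)] finF that independentD[of F F "\<lambda>v. c v - c' v" v] by auto
  moreover have "c v = 0" "c' v = 0" if "v \<notin> F"
    using that c(2) \<open>{v. c' v \<noteq> 0} \<subseteq> F\<close> by blast+
  ultimately show "c v = c' v" by (cases "v \<in> F") auto
qed

end

text \<open>A facet of the polytope lies in a hyperplane that misses 0, and this hyperplane cuts the
  unit sphere in a geodesic sphere. Genericity therefore allows at most \<open>d + 1\<close>
  vertices, and as the facet has dimension \<open>d\<close>, it is a simplex.\<close>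

lemma admissible_simplicial_fan:
  assumes "admissible_triangulation d K"
  shows "simplicial_fan (K :: 'a::euclidean_space set set)"
proof -
  obtain S where dim: "DIM('a) = d + 1" and S: "finite S" "S \<subseteq> sphere 0 1" "generic_on_sphere d S"
    "0 \<in> interior (convex hull S)" and K: "K = boundary_complex (convex hull S)"
    using assms unfolding admissible_triangulation_def by auto
  define P where "P = convex hull S"
  define ext where "ext G = {v. v extreme_point_of G}" for G :: "'a set"
  have poly: "polytope P" "polyhedron P" using S by (auto simp: P_def polytope_convex_hull polyhedron_convex_hull)
  have compact: "compact P" using S by (simp add: P_def finite_imp_compact_convex_hull)
  have extS: "ext P \<subseteq> S" using extreme_points_of_convex_hull by (auto simp: P_def ext_def)
  have ext_face: "ext G = ext P \<inter> G" if "G face_of P" for G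
    using extreme_point_of_face[OF that] by (auto simp: ext_def)
  have ext_hull: "convex hull (ext G) = G" if "G face_of P" for G
    using Krein_Milman_Minkowski[of G] face_of_imp_compact[OF _ compact that] face_of_imp_convex[OF that]
    by (simp add: ext_def P_def)
  have aff_P: "aff_dim P = d + 1"
    using S(4) dim aff_dim_nonempty_interior[of P] by (auto simp: P_def)
  have facet: "\<not> affine_dependent (ext G) \<and> independent (ext G) \<and>
      (\<exists>a. (\<forall>v\<in>ext P. a \<bullet> v \<le> 1) \<and> (\<forall>v\<in>ext P. a \<bullet> v = 1 \<longleftrightarrow> v \<in> ext G))"
    if G: "G facet_of P" for G
  proof -
    have face: "G face_of P" using G by (rule facet_of_imp_face_of)
    then have "G exposed_face_of P" using exposed_face_of_polyhedron[OF poly(2)] by simp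
    then obtain a b where ab: "P \<subseteq> {x. a \<bullet> x \<le> b}" "G = P \<inter> {x. a \<bullet> x = b}"
      unfolding exposed_face_of_def by auto
    \<comment> \<open>As 0 lies in the polytope, \<open>b\<close> is not negative. For
      \<open>b = 0\<close> the half-space would contain a ball around 0, which forces
      \<open>a = 0\<close> and \<open>G = P\<close>; the point tested is that of the ball farthest
      in direction \<open>a\<close>.\<close>
    have "0 < b"
    proof (rule ccontr)
      assume "\<not> 0 < b"
      have 0: "0 \<in> P" using S(4) interior_subset by (auto simp: P_def)
      with ab \<open>\<not> 0 < b\<close> have "b = 0" by fastforce
      obtain e where e: "0 < e" "cball 0 e \<subseteq> P"
        using S(4) by (auto simp: P_def mem_interior_cball)
      have "a = 0"
      proof (rule ccontr)
        assume "a \<noteq> 0"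
        then have "(e / norm a) *\<^sub>R a \<in> P" using e by (intro subsetD[OF e(2)]) simp
        with ab \<open>b = 0\<close> have "(e / norm a) * (a \<bullet> a) \<le> 0" by auto
        with \<open>a \<noteq> 0\<close> e(1) show False
          by (simp add: mult_le_0_iff divide_le_0_iff not_le flip: inner_gt_zero_iff)
      qed
      with ab \<open>b = 0\<close> have "G = P" by auto
      with G show False by simp
    qed
    define a' where "a' = a /\<^sub>R b"
    have a'1: "a' \<bullet> v \<le> 1" if "v \<in> P" for v
      using ab(1) that \<open>0 < b\<close> by (auto simp: a'_def field_simps)
    have a'2: "a' \<bullet> v = 1 \<longleftrightarrow> v \<in> G" if "v \<in> P" for v
      using ab(2) that \<open>0 < b\<close> by (auto simp: a'_def field_simps)
    have ext_P: "ext P \<subseteq> P" by (auto simp: ext_def extreme_point_of_def)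
    have extG: "ext G \<subseteq> G" "ext G \<subseteq> S" using ext_face[OF face] extS by auto
    have finG: "finite (ext G)" using extG S(1) by (auto intro: finite_subset)
    have one: "a' \<bullet> v = 1" if "v \<in> ext G" for v
      using that a'2 ext_face[OF face] ext_P by auto
    have "card (ext G) \<le> d + 1"
    proof (rule ccontr)
      assume "\<not> card (ext G) \<le> d + 1"
      then obtain T where T: "T \<subseteq> ext G" "card T = d + 2"
        using obtain_subset_with_card_n[of "d + 2" "ext G"] by auto
      then have "ext G \<noteq> {}" by auto
      then have "a' \<noteq> 0" using one by fastforce
      then have "(a' /\<^sub>R norm a') \<in> sphere 0 1" by simp
      \<comment> \<open>For a unit vector \<open>v\<close>, \<open>a' \<bullet> v = 1\<close> says
        that the normalised \<open>a'\<close> has inner product \<open>1 / norm a'\<close> with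
        \<open>v\<close>; the radius is the corresponding angle.\<close>
      moreover have "T \<subseteq> geodesic_sphere (a' /\<^sub>R norm a') (arccos (1 / norm a'))"
        using T(1) one subset_trans[OF T(1) subset_trans[OF extG(2) S(2)]]
        by (auto simp: geodesic_sphere_def inverse_eq_divide)
      ultimately show False
        using S(3) T extG unfolding generic_on_sphere_def by blast
    qed
    moreover have "aff_dim (ext G) = d"
      using G aff_P ext_hull[OF face] aff_dim_convex_hull[of "ext G"] by (simp add: facet_of_def)
    ultimately have indep: "\<not> affine_dependent (ext G)"
      using aff_dim_le_card[OF finG] finG by (simp add: affine_independent_iff_card)
    \<comment> \<open>Pairing a linear relation with \<open>a'\<close>, which is 1 on these
      vertices, shows that the coefficients sum to 0. So it is an affine relation, which is
      trivial.\<close>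
    have "c v = 0" if c: "(\<Sum>v\<in>ext G. c v *\<^sub>R v) = 0" "v \<in> ext G" for c v
    proof -
      have "sum c (ext G) = (\<Sum>v\<in>ext G. c v * (a' \<bullet> v))" using one by simp
      also have "\<dots> = a' \<bullet> (\<Sum>v\<in>ext G. c v *\<^sub>R v)" by (simp add: inner_sum_right)
      finally have "sum c (ext G) = 0" using c by simp
      with c indep show ?thesis using affine_dependent_explicit_finite[OF finG] by blast
    qed
    then have "independent (ext G)"
      unfolding independent_explicit using finG by blast
    with indep a'1 a'2 ext_P ext_face[OF face] show ?thesis by blast
  qed
  have facet_in: "t \<in> K" if G: "G facet_of P" and t: "t \<subseteq> ext G" "t \<noteq> {}" for G t
  proof -
    have face: "G face_of P" using G by (rule facet_of_imp_face_of)
    \<comment> \<open>The facet is a simplex, so every set of its vertices spans a face.\<close>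
    have "convex hull t face_of G"
      using face_of_convex_hull_affine_independent[of "ext G" "convex hull t"] facet[OF G] t(1) ext_hull[OF face]
      by auto
    then have 1: "convex hull t face_of P" using face face_of_trans by blast
    have "convex hull t \<subseteq> G" using \<open>convex hull t face_of G\<close> face_of_imp_subset by blast
    moreover have "G \<noteq> P" using G by auto
    ultimately have 2: "convex hull t \<noteq> P" using face face_of_imp_subset by blast
    have "\<not> affine_dependent t" using facet[OF G] t(1) affine_independent_subset by blast
    then have "{v. v extreme_point_of convex hull t} = t"
      by (simp add: extreme_point_of_convex_hull_affine_independent)
    with 1 2 t(2) show ?thesis unfolding K boundary_complex_def P_def[symmetric]
      by (intro CollectI exI[of _ "convex hull t"]) auto
  qed
  have K_facet: "\<exists>G. G facet_of P \<and> s \<subseteq> ext G \<and> s \<noteq> {}" if s: "s \<in> K" for s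
  proof -
    obtain F where F: "F face_of P" "F \<noteq> {}" "F \<noteq> P" "s = ext F"
      using s by (auto simp: K boundary_complex_def P_def ext_def)
    obtain G where G: "G facet_of P" "F \<subseteq> G"
      using face_of_polyhedron_subset_facet[OF poly(2) F(1,2,3)] by blast
    have "s \<subseteq> ext G"
      using F G ext_face[OF F(1)] ext_face[OF facet_of_imp_face_of[OF G(1)]] by auto
    moreover have "s \<noteq> {}" using F ext_hull[OF F(1)] by auto
    ultimately show ?thesis using G by blast
  qed
  have verts: "\<Union>K \<subseteq> ext P"
    using K_facet ext_face facet_of_imp_face_of by blast
  have facets: "\<exists>G. G facet_of P \<and> F = ext G" if F: "F \<in> facets K" for F
  proof -
    have "F \<in> K" and max: "\<And>t. t \<in> K \<Longrightarrow> F \<subseteq> t \<Longrightarrow> t = F" using F by (simp_all add: facets_def)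
    then obtain G where G: "G facet_of P" "F \<subseteq> ext G" "F \<noteq> {}"
      using K_facet by meson
    then have "ext G \<in> K" using facet_in[OF G(1), of "ext G"] by auto
    from max[OF this G(2)] G(1) show ?thesis by blast
  qed
  have "finite K"
    using verts extS S(1) by (intro finite_subset[of K "Pow S"]) auto
  moreover have "K \<noteq> {}"
  proof -
    obtain G where G: "G facet_of P" using polytope_facet_exists[OF poly(1)] aff_P by auto
    moreover have "ext G \<noteq> {}"
      using ext_hull[OF facet_of_imp_face_of[OF G]] G by (auto simp: facet_of_def)
    ultimately show ?thesis using facet_in by blast
  qed
  moreover have "\<exists>a. (\<forall>v\<in>\<Union>K. a \<bullet> v \<le> 1) \<and> (\<forall>v\<in>\<Union>K. a \<bullet> v = 1 \<longleftrightarrow> v \<in> F)"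
    if F: "F \<in> facets K" for F
  proof -
    obtain G where G: "G facet_of P" "F = ext G" using facets[OF F] by blast
    then obtain a where "\<forall>v\<in>ext P. a \<bullet> v \<le> 1" "\<forall>v\<in>ext P. a \<bullet> v = 1 \<longleftrightarrow> v \<in> F"
      using facet by metis
    with verts show ?thesis by (intro exI[of _ a]) blast
  qed
  moreover have "independent F" if "F \<in> facets K" for F
    using facets[OF that] facet by metis
  moreover have "t \<in> K" if "s \<in> K" "t \<subseteq> s" "t \<noteq> {}" for s t
    using K_facet[OF that(1)] facet_in[of _ t] that by (meson order_trans)
  moreover have "\<Union>K \<subseteq> sphere 0 1"
    using verts extS S(2) by (meson order_trans)
  moreover have "s \<noteq> {}" if "s \<in> K" for s
    using K_facet[OF that] by meson
  ultimately show ?thesis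
    by (intro simplicial_fan.intro) assumption+
qed

subsection \<open>The simplicial ball is embedded\<close>

locale oriented_fan = simplicial_fan K for K :: "'a::euclidean_space set set" +
  fixes \<rho> :: real and R :: "('a \<times> 'a) set"
  assumes \<rho>_pos: "0 < \<rho>" and \<rho>_less_1: "\<rho> < 1"
    and orientation: "facet_acyclic_orientation K R"
begin

declare Union_iff [simp del]

abbreviation B where "B \<equiv> simplicial_ball \<rho> R K"

lemma norm_vertex: "v \<in> \<Union>K \<Longrightarrow> norm v = 1"
  using unit_vertices by auto

lemma zero_notin: "0 \<notin> \<Union>K"
  using norm_vertex by fastforce

lemma scaled_notin: "v \<in> \<Union>K \<Longrightarrow> \<rho> *\<^sub>R v \<notin> \<Union>K"
  using norm_vertex[of v] norm_vertex[of "\<rho> *\<^sub>R v"] \<rho>_pos \<rho>_less_1 by auto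

lemma facet_subset: "F \<in> facets K \<Longrightarrow> F \<subseteq> \<Union>K"
  using facet_in by auto

lemma facet_total:
  assumes "F \<in> facets K" "x \<in> F" "y \<in> F" "x \<noteq> y"
  shows "(x, y) \<in> R \<or> (y, x) \<in> R"
proof -
  have "{x, y} \<in> K" using face_closed[OF facet_in[OF assms(1)], of "{x, y}"] assms by simp
  with orientation assms(4) show ?thesis unfolding facet_acyclic_orientation_def by metis
qed

lemma irrefl_orientation: "(x, x) \<notin> R"
  using orientation unfolding facet_acyclic_orientation_def by auto

lemma acyclic_orientation: "F \<in> facets K \<Longrightarrow> acyclic (Restr R F)"
  using orientation unfolding facet_acyclic_orientation_def by simp

lemma ball_points: "\<Union>B \<subseteq> insert 0 (\<Union>K \<union> (\<lambda>v. \<rho> *\<^sub>R v) ` \<Union>K)"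
proof
  fix x assume "x \<in> \<Union>B"
  then obtain t where "t \<in> B" "x \<in> t" by blast
  then obtain F where F: "F \<in> facets K"
    "(\<exists>w\<in>F. x \<in> prism_simplex \<rho> R F w) \<or> x \<in> insert 0 ((\<lambda>v. \<rho> *\<^sub>R v) ` F)"
    unfolding simplicial_ball_def by blast
  then have "x \<in> insert 0 (F \<union> (\<lambda>v. \<rho> *\<^sub>R v) ` F)"
    unfolding prism_simplex_def by blast
  with facet_subset[OF F(1)] show "x \<in> insert 0 (\<Union>K \<union> (\<lambda>v. \<rho> *\<^sub>R v) ` \<Union>K)" by blast
qed

lemma finite_ball_points: "finite (\<Union>B)"
  using ball_points finite_verts by (auto intro: finite_subset)

lemma prism_in_ball:
  "F \<in> facets K \<Longrightarrow> w \<in> F \<Longrightarrow> t \<subseteq> prism_simplex \<rho> R F w \<Longrightarrow> t \<noteq> {} \<Longrightarrow> t \<in> B"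
  unfolding simplicial_ball_def by (intro CollectI conjI bexI[of _ F] disjI1 bexI[of _ w])

lemma cone_in_ball:
  "F \<in> facets K \<Longrightarrow> t \<subseteq> insert 0 ((\<lambda>v. \<rho> *\<^sub>R v) ` F) \<Longrightarrow> t \<noteq> {} \<Longrightarrow> t \<in> B"
  unfolding simplicial_ball_def by (intro CollectI conjI bexI[of _ F] disjI2)

lemma ball_cases:
  assumes "t \<in> B"
  shows "\<exists>F\<in>facets K. (\<exists>w\<in>F. t \<subseteq> prism_simplex \<rho> R F w) \<or> t \<subseteq> insert 0 ((\<lambda>v. \<rho> *\<^sub>R v) ` F)"
  using assms by (simp add: simplicial_ball_def)

lemma ball_down_closed:
  assumes "t \<in> B" "s \<subseteq> t" "s \<noteq> {}"
  shows "s \<in> B"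
proof -
  obtain F where F: "F \<in> facets K"
    and "(\<exists>w\<in>F. t \<subseteq> prism_simplex \<rho> R F w) \<or> t \<subseteq> insert 0 ((\<lambda>v. \<rho> *\<^sub>R v) ` F)"
    using ball_cases[OF assms(1)] by (rule bexE)
  then show ?thesis
  proof (elim disjE bexE)
    show "s \<in> B" if "w \<in> F" "t \<subseteq> prism_simplex \<rho> R F w" for w
      using F that(1) order_trans[OF assms(2) that(2)] assms(3) by (rule prism_in_ball)
    show "s \<in> B" if "t \<subseteq> insert 0 ((\<lambda>v. \<rho> *\<^sub>R v) ` F)"
      using F order_trans[OF assms(2) that] assms(3) by (rule cone_in_ball)
  qed
qed

lemma facet_maximum:
  assumes F: "F \<in> facets K"
  obtains w where "w \<in> F" "F = {v \<in> F. (v, w) \<in> R\<^sup>=}"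
proof -
  have "finite (Restr R F)"
    using finite_subset[OF facet_subset[OF F] finite_verts] by auto
  then have "wf ((Restr R F)\<inverse>)"
    using acyclic_orientation[OF F] by (simp add: finite_acyclic_wf_converse)
  then obtain w where w: "w \<in> F" "\<And>y. (y, w) \<in> (Restr R F)\<inverse> \<Longrightarrow> y \<notin> F"
    by (rule wfE_min'[OF _ simplex_nonempty[OF facet_in[OF F]]]) blast
  have "(v, w) \<in> R\<^sup>=" if "v \<in> F" for v
    using w that facet_total[OF F that w(1)] by blast
  then have "F = {v \<in> F. (v, w) \<in> R\<^sup>=}" by blast
  with w(1) show thesis by (rule that)
qed

text \<open>The staircase simplex whose pivot is the greatest vertex contains the whole outer
  facet.\<close>

lemma K_subset_ball: "K \<subseteq> B"
proof
  fix s assume s: "s \<in> K"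
  then obtain F where F: "F \<in> facets K" "s \<subseteq> F" by (rule in_facet)
  obtain w where w: "w \<in> F" "F = {v \<in> F. (v, w) \<in> R\<^sup>=}" using facet_maximum[OF F(1)] by blast
  then have "F \<subseteq> prism_simplex \<rho> R F w" unfolding prism_simplex_def by (metis Un_upper2)
  with F s w(1) simplex_nonempty show "s \<in> B" by (meson prism_in_ball order_trans)
qed

lemma layered_ball:
  "layered_complex (facets K) (\<Union>K) R 0 (\<lambda>v. \<rho> *\<^sub>R v) (\<lambda>v. v) B K"
proof
  show "t \<in> B \<Longrightarrow> t \<notin> K \<Longrightarrow> \<exists>F\<in>facets K.
      (\<exists>w\<in>F. t \<subseteq> (\<lambda>v. \<rho> *\<^sub>R v) ` {v \<in> F. (w, v) \<in> R\<^sup>=} \<union> (\<lambda>v. v) ` {v \<in> F. (v, w) \<in> R\<^sup>=}) \<or>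
      t \<subseteq> insert 0 ((\<lambda>v. \<rho> *\<^sub>R v) ` F)" for t
    unfolding image_ident prism_simplex_def[symmetric] by (rule ball_cases)
  show "t \<in> B" if "F \<in> facets K" "w \<in> F" "t \<noteq> {}"
    "t \<subseteq> (\<lambda>v. \<rho> *\<^sub>R v) ` {v \<in> F. (w, v) \<in> R\<^sup>=} \<union> (\<lambda>v. v) ` {v \<in> F. (v, w) \<in> R\<^sup>=}" for F w t
    using that unfolding image_ident prism_simplex_def[symmetric] by (intro prism_in_ball)
  show "inj_on (\<lambda>v. \<rho> *\<^sub>R v) (\<Union>K)" using \<rho>_pos by (auto simp: inj_on_def)
  show "0 \<notin> s \<and> (\<lambda>v. \<rho> *\<^sub>R v) ` \<Union>K \<inter> s = {}" if "s \<in> K" for s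
    using that zero_notin scaled_notin by blast
  show "(\<lambda>v. v) ` s \<in> K" if "F \<in> facets K" "s \<subseteq> F" "s \<noteq> {}" for F s
    using face_closed[OF facet_in] that by simp
  show "v \<noteq> \<rho> *\<^sub>R v'" if "v \<in> \<Union>K" "v' \<in> \<Union>K" for v v'
    using that scaled_notin by blast
  show "\<rho> *\<^sub>R v \<noteq> 0" "v \<noteq> 0" if "v \<in> \<Union>K" for v
    using that zero_notin \<rho>_pos by auto
  show "F \<noteq> {}" if "F \<in> facets K" for F using that facet_in simplex_nonempty by blast
qed (fact Union_facets[symmetric] finite_verts facet_total acyclic_orientation irrefl_orientation
    finite_ball_points cone_in_ball K_subset_ball)+

end

sublocale oriented_fan \<subseteq> ball: layered_complex "facets K" "\<Union>K" R 0 "\<lambda>v. \<rho> *\<^sub>R v" "\<lambda>v. v" B K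
  by (rule layered_ball)

context oriented_fan
begin

section \<open>Points of the ball in radial terms\<close>

lemma sum_ball_points:
  assumes "{x. f x \<noteq> 0} \<subseteq> \<Union>B"
  shows "sum f (\<Union>B) = f 0 + (\<Sum>v\<in>\<Union>K. f v + f (\<rho> *\<^sub>R v))"
proof -
  have "sum f (\<Union>B) = sum f (insert 0 (\<Union>K \<union> (\<lambda>v. \<rho> *\<^sub>R v) ` \<Union>K))"
    using ball_points finite_verts assms by (intro sum.mono_neutral_left) auto
  also have "\<dots> = f 0 + sum f (\<Union>K \<union> (\<lambda>v. \<rho> *\<^sub>R v) ` \<Union>K)"
  proof (rule sum.insert)
    have "0 \<notin> (\<lambda>v. \<rho> *\<^sub>R v) ` \<Union>K" using ball.inn_neq_org by (metis imageE)
    then show "0 \<notin> \<Union>K \<union> (\<lambda>v. \<rho> *\<^sub>R v) ` \<Union>K" using zero_notin by simp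
  qed (simp add: finite_verts)
  also have "sum f (\<Union>K \<union> (\<lambda>v. \<rho> *\<^sub>R v) ` \<Union>K) = sum f (\<Union>K) + sum f ((\<lambda>v. \<rho> *\<^sub>R v) ` \<Union>K)"
  proof (rule sum.union_disjoint)
    show "\<Union>K \<inter> (\<lambda>v. \<rho> *\<^sub>R v) ` \<Union>K = {}"
    proof (rule equals0I)
      fix x assume "x \<in> \<Union>K \<inter> (\<lambda>v. \<rho> *\<^sub>R v) ` \<Union>K"
      then obtain v where "v \<in> \<Union>K" "x = \<rho> *\<^sub>R v" "x \<in> \<Union>K" by (elim IntE imageE)
      with scaled_notin show False by simp
    qed
  qed (simp_all add: finite_verts)
  also have "sum f ((\<lambda>v. \<rho> *\<^sub>R v) ` \<Union>K) = (\<Sum>v\<in>\<Union>K. f (\<rho> *\<^sub>R v))"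
    by (simp only: sum.reindex[OF ball.inj_inn] o_def)
  finally show ?thesis by (simp add: sum.distrib)
qed

text \<open>
  Inner and outer copy of a vertex lie on the same ray; \<open>radial u\<close> collects the coefficients of a
  point with respect to the rays.
\<close>

definition radial :: "('a \<Rightarrow> real) \<Rightarrow> 'a \<Rightarrow> real" where
  "radial u v = (if v \<in> \<Union>K then u v + \<rho> * u (\<rho> *\<^sub>R v) else 0)"

lemma support_ball: "u \<in> realization B \<Longrightarrow> {x. u x \<noteq> 0} \<subseteq> \<Union>B"
  by (auto simp: realization_def)

lemma barycenter_radial:
  assumes "u \<in> realization B"
  shows "barycenter u = (\<Sum>v\<in>\<Union>K. radial u v *\<^sub>R v)"
proof -
  have "barycenter u = (\<Sum>v\<in>\<Union>B. u v *\<^sub>R v)"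
    using finite_ball_points support_ball[OF assms] by (rule barycenter_eq_sum)
  also have "\<dots> = (\<Sum>v\<in>\<Union>K. u v *\<^sub>R v + u (\<rho> *\<^sub>R v) *\<^sub>R (\<rho> *\<^sub>R v))"
    using support_ball[OF assms] by (subst sum_ball_points) auto
  also have "\<dots> = (\<Sum>v\<in>\<Union>K. radial u v *\<^sub>R v)"
    by (intro sum.cong) (auto simp: radial_def algebra_simps)
  finally show ?thesis .
qed

lemma total_mass:
  assumes "u \<in> realization B"
  shows "u 0 + (\<Sum>v\<in>\<Union>K. u v + u (\<rho> *\<^sub>R v)) = 1"
  using sum_ball_points[OF support_ball[OF assms]] assms by (simp add: ball.realization_iff)

definition prism_type :: "'a set \<Rightarrow> 'a \<Rightarrow> ('a \<Rightarrow> real) \<Rightarrow> bool" where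
  "prism_type F w u \<longleftrightarrow> F \<in> facets K \<and> w \<in> F \<and> u 0 = 0 \<and>
     (\<forall>v\<in>\<Union>K. u v \<noteq> 0 \<longrightarrow> v \<in> F \<and> (v, w) \<in> R\<^sup>=) \<and>
     (\<forall>v\<in>\<Union>K. u (\<rho> *\<^sub>R v) \<noteq> 0 \<longrightarrow> v \<in> F \<and> (w, v) \<in> R\<^sup>=)"

definition cone_type :: "'a set \<Rightarrow> ('a \<Rightarrow> real) \<Rightarrow> bool" where
  "cone_type F u \<longleftrightarrow> F \<in> facets K \<and>
     (\<forall>v\<in>\<Union>K. u v = 0) \<and> (\<forall>v\<in>\<Union>K. u (\<rho> *\<^sub>R v) \<noteq> 0 \<longrightarrow> v \<in> F)"

lemma prism_type_facet: "prism_type F w u \<Longrightarrow> F \<in> facets K \<and> w \<in> F"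
  and prism_type_origin: "prism_type F w u \<Longrightarrow> u 0 = 0"
  and prism_type_outer: "prism_type F w u \<Longrightarrow> v \<in> \<Union>K \<Longrightarrow> u v \<noteq> 0 \<Longrightarrow> v \<in> F \<and> (v, w) \<in> R\<^sup>="
  and prism_type_inner: "prism_type F w u \<Longrightarrow> v \<in> \<Union>K \<Longrightarrow> u (\<rho> *\<^sub>R v) \<noteq> 0 \<Longrightarrow> v \<in> F \<and> (w, v) \<in> R\<^sup>="
  by (metis prism_type_def)+

lemma cone_type_outer: "cone_type F u \<Longrightarrow> v \<in> \<Union>K \<Longrightarrow> u v = 0"
  unfolding cone_type_def by blast

lemma prism_or_cone_type:
  assumes u: "u \<in> realization B"
  shows "(\<exists>F w. prism_type F w u) \<or> (\<exists>F. cone_type F u)"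
proof -
  have "{x. u x \<noteq> 0} \<in> B" using u by (simp add: realization_def)
  then obtain F where F: "F \<in> facets K" and
    "(\<exists>w\<in>F. {x. u x \<noteq> 0} \<subseteq> prism_simplex \<rho> R F w) \<or> {x. u x \<noteq> 0} \<subseteq> insert 0 ((\<lambda>v. \<rho> *\<^sub>R v) ` F)"
    by (rule bexE[OF ball_cases])
  then show ?thesis
  proof (elim disjE bexE)
    fix w assume w: "w \<in> F" and supp: "{x. u x \<noteq> 0} \<subseteq> prism_simplex \<rho> R F w"
    have in_F: "v \<in> F \<and> (v, w) \<in> R\<^sup>=" if "v \<in> \<Union>K" "u v \<noteq> 0" for v
    proof -
      have "v \<in> prism_simplex \<rho> R F w" using that(2) supp by blast
      then show ?thesis
        using that(1) scaled_notin facet_subset[OF F] unfolding prism_simplex_def by blast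
    qed
    moreover have "v \<in> F \<and> (w, v) \<in> R\<^sup>=" if "v \<in> \<Union>K" "u (\<rho> *\<^sub>R v) \<noteq> 0" for v
    proof -
      have "\<rho> *\<^sub>R v \<in> prism_simplex \<rho> R F w" using that(2) supp by blast
      moreover have "\<rho> *\<^sub>R v \<notin> F"
        using scaled_notin[OF that(1)] facet_subset[OF F] by (rule contra_subsetD[rotated])
      ultimately obtain v' where "v' \<in> F" "(w, v') \<in> R\<^sup>=" "\<rho> *\<^sub>R v = \<rho> *\<^sub>R v'"
        unfolding prism_simplex_def by blast
      then show ?thesis using \<rho>_pos by simp
    qed
    moreover have "u 0 = 0"
    proof (rule ccontr)
      assume "u 0 \<noteq> 0"
      then have "0 \<in> prism_simplex \<rho> R F w" using supp by blast
      then obtain v where "v \<in> F" "0 = v \<or> 0 = \<rho> *\<^sub>R v" unfolding prism_simplex_def by blast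
      then show False using zero_notin \<rho>_pos facet_subset[OF F] by auto
    qed
    ultimately have "prism_type F w u" unfolding prism_type_def using F w by blast
    then show ?thesis by blast
  next
    assume supp: "{x. u x \<noteq> 0} \<subseteq> insert 0 ((\<lambda>v. \<rho> *\<^sub>R v) ` F)"
    have "u v = 0" if "v \<in> \<Union>K" for v
    proof (rule ccontr)
      assume "u v \<noteq> 0"
      then have "v \<in> insert 0 ((\<lambda>v. \<rho> *\<^sub>R v) ` F)" using supp by blast
      then show False using that zero_notin scaled_notin facet_subset[OF F] by blast
    qed
    moreover have "v \<in> F" if "v \<in> \<Union>K" "u (\<rho> *\<^sub>R v) \<noteq> 0" for v
    proof -
      have "\<rho> *\<^sub>R v \<in> insert 0 ((\<lambda>v. \<rho> *\<^sub>R v) ` F)" using that(2) supp by blast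
      then show ?thesis using that(1) zero_notin \<rho>_pos by auto
    qed
    ultimately have "cone_type F u" unfolding cone_type_def using F by blast
    then show ?thesis by blast
  qed
qed

lemma nonneg: "u \<in> realization B \<Longrightarrow> 0 \<le> u x"
  by (simp add: realization_def)

text \<open>Radial coefficient and inner mass give the outer mass on each ray, and total mass 1 then
  gives the mass of the origin.\<close>

lemma ball_point_eqI:
  assumes "u \<in> realization B" "u' \<in> realization B"
    and "radial u = radial u'" "\<And>v. v \<in> \<Union>K \<Longrightarrow> u (\<rho> *\<^sub>R v) = u' (\<rho> *\<^sub>R v)"
  shows "u = u'"
proof
  have out: "u v = u' v" if "v \<in> \<Union>K" for v
    using fun_cong[OF assms(3), of v] that assms(4)[OF that] by (simp add: radial_def)
  then have zero: "u 0 = u' 0"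
    using total_mass[OF assms(1)] total_mass[OF assms(2)] assms(4) by simp
  fix x
  show "u x = u' x"
  proof (cases "x \<in> insert 0 (\<Union>K \<union> (\<lambda>v. \<rho> *\<^sub>R v) ` \<Union>K)")
    case True
    then show ?thesis using out zero assms(4) by blast
  next
    case False
    then have "x \<notin> \<Union>B" using ball_points by blast
    then have "u x = 0" "u' x = 0" using support_ball assms(1,2) by blast+
    then show ?thesis by simp
  qed
qed

text \<open>
  As \<open>\<rho> \<noteq> 1\<close>, the radial coefficients determine the total mass of the inner vertices, so inner masses
  that are comparable pointwise agree.
\<close>

lemma ball_point_eqI_mono:
  assumes u: "u \<in> realization B" "u' \<in> realization B" and rad: "radial u = radial u'"
    and org: "u 0 = 0" "u' 0 = 0"
    and le: "\<And>v. v \<in> \<Union>K \<Longrightarrow> u (\<rho> *\<^sub>R v) \<le> u' (\<rho> *\<^sub>R v)"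
  shows "u = u'"
proof (rule ball_point_eqI[OF u rad])
  have mass: "sum (radial u) (\<Union>K) + (1 - \<rho>) * (\<Sum>v\<in>\<Union>K. u (\<rho> *\<^sub>R v)) = 1"
    if "u \<in> realization B" "u 0 = 0" for u
  proof -
    have "sum (radial u) (\<Union>K) + (1 - \<rho>) * (\<Sum>v\<in>\<Union>K. u (\<rho> *\<^sub>R v)) = (\<Sum>v\<in>\<Union>K. u v + u (\<rho> *\<^sub>R v))"
      by (simp add: radial_def sum_distrib_left sum.distrib[symmetric] algebra_simps)
    then show ?thesis using total_mass[OF that(1)] that(2) by simp
  qed
  have "(1 - \<rho>) * (\<Sum>v\<in>\<Union>K. u (\<rho> *\<^sub>R v)) = (1 - \<rho>) * (\<Sum>v\<in>\<Union>K. u' (\<rho> *\<^sub>R v))"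
    using mass[OF u(1) org(1)] mass[OF u(2) org(2)] unfolding rad by linarith
  then have "(\<Sum>v\<in>\<Union>K. u' (\<rho> *\<^sub>R v) - u (\<rho> *\<^sub>R v)) = 0"
    using \<rho>_less_1 by (simp add: sum_subtractf)
  then have "\<forall>v\<in>\<Union>K. u' (\<rho> *\<^sub>R v) - u (\<rho> *\<^sub>R v) = 0"
    using finite_verts le by (subst (asm) sum_nonneg_eq_0_iff) auto
  then show "u (\<rho> *\<^sub>R v) = u' (\<rho> *\<^sub>R v)" if "v \<in> \<Union>K" for v
    using that by fastforce
qed

text \<open>
  If the inner masses were incomparable at \<open>v1\<close> and \<open>v2\<close>, then the pivots \<open>w\<close> and \<open>w'\<close> would satisfy
  \<open>v2 \<le> w \<le> v1\<close> in one facet and \<open>v1 \<le> w' \<le> v2\<close> in the other.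
\<close>

lemma inj_barycenter_prism:
  assumes u: "u \<in> realization B" "u' \<in> realization B" and rad: "radial u = radial u'"
    and type: "prism_type F w u" "prism_type F' w' u'"
  shows "u = u'"
proof (cases "\<forall>v\<in>\<Union>K. u (\<rho> *\<^sub>R v) \<le> u' (\<rho> *\<^sub>R v)")
  case True
  show ?thesis
    using u rad prism_type_origin[OF type(1)] prism_type_origin[OF type(2)] bspec[OF True]
    by (rule ball_point_eqI_mono)
next
  case False
  then obtain v1 where v1: "v1 \<in> \<Union>K" "u' (\<rho> *\<^sub>R v1) < u (\<rho> *\<^sub>R v1)" by fastforce
  have "\<forall>v\<in>\<Union>K. u' (\<rho> *\<^sub>R v) \<le> u (\<rho> *\<^sub>R v)"
  proof (rule ccontr)
    assume "\<not> (\<forall>v\<in>\<Union>K. u' (\<rho> *\<^sub>R v) \<le> u (\<rho> *\<^sub>R v))"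
    then obtain v2 where v2: "v2 \<in> \<Union>K" "u (\<rho> *\<^sub>R v2) < u' (\<rho> *\<^sub>R v2)" by fastforce
    \<comment> \<open>With equal radial coefficients, more inner mass in \<open>a\<close> has to be
      balanced by more outer mass in \<open>b\<close>.\<close>
    have pos: "a (\<rho> *\<^sub>R v) \<noteq> 0 \<and> b v \<noteq> 0"
      if "v \<in> \<Union>K" "b (\<rho> *\<^sub>R v) < a (\<rho> *\<^sub>R v)" "a \<in> realization B" "b \<in> realization B"
        "radial a = radial b" for v a b
    proof -
      have "a v + \<rho> * a (\<rho> *\<^sub>R v) = b v + \<rho> * b (\<rho> *\<^sub>R v)"
        using fun_cong[OF that(5), of v] that(1) by (simp add: radial_def)
      moreover have "\<rho> * b (\<rho> *\<^sub>R v) < \<rho> * a (\<rho> *\<^sub>R v)" using that(2) \<rho>_pos by simp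
      ultimately show ?thesis
        using nonneg[OF that(3), of v] nonneg[OF that(4), of "\<rho> *\<^sub>R v"] that(2) by linarith
    qed
    have "v1 \<in> F" "(w, v1) \<in> R\<^sup>=" "v1 \<in> F'" "(v1, w') \<in> R\<^sup>="
      using pos[OF v1 u rad] prism_type_inner[OF type(1) v1(1)] prism_type_outer[OF type(2) v1(1)]
      by simp_all
    moreover have "v2 \<in> F'" "(w', v2) \<in> R\<^sup>=" "v2 \<in> F" "(v2, w) \<in> R\<^sup>="
      using pos[OF v2 u(2,1) rad[symmetric]] prism_type_inner[OF type(2) v2(1)]
        prism_type_outer[OF type(1) v2(1)]
      by simp_all
    moreover have "F \<in> facets K" "F' \<in> facets K" "w \<in> F" "w' \<in> F'"
      using prism_type_facet[OF type(1)] prism_type_facet[OF type(2)] by simp_all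
    ultimately have "(v2, v1) \<in> R\<^sup>=" "(v1, v2) \<in> R\<^sup>="
      using ball.facet_trans[of F v2 w v1] ball.facet_trans[of F' v1 w' v2] by blast+
    \<comment> \<open>The direction of the edge between \<open>v1\<close> and \<open>v2\<close> is
      the same in both facets, so the two opposite relations contradict asymmetry inside
      \<open>F\<close>.\<close>
    then have "v1 = v2"
      using ball.facet_asym[of F v1 v2] \<open>F \<in> facets K\<close> \<open>v1 \<in> F\<close> \<open>v2 \<in> F\<close> by blast
    with v1 v2 show False by simp
  qed
  then have "u' = u"
    by (intro ball_point_eqI_mono[OF u(2,1) rad[symmetric]] prism_type_origin[OF type(1)]
        prism_type_origin[OF type(2)]) (rule bspec)
  then show ?thesis by (rule sym)
qed

text \<open>For a given radial coefficient, inner mass costs more than outer mass because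
  \<open>\<rho> < 1\<close>. The prism point already spends total mass 1 on the rays; the cone
  point, using inner mass only, spends at least as much on each ray. So it has nothing left for the
  origin, and the inner masses are comparable.\<close>

lemma inj_barycenter_cone:
  assumes u: "u \<in> realization B" "u' \<in> realization B" and rad: "radial u = radial u'"
    and type: "cone_type F u" "prism_type F' w' u'"
  shows "u = u'"
proof -
  have eq: "\<rho> * u (\<rho> *\<^sub>R v) = u' v + \<rho> * u' (\<rho> *\<^sub>R v)" if "v \<in> \<Union>K" for v
    using fun_cong[OF rad, of v] cone_type_outer[OF type(1) that] that by (simp add: radial_def)
  have le: "\<rho> * (u' v + u' (\<rho> *\<^sub>R v)) \<le> \<rho> * u (\<rho> *\<^sub>R v)" if "v \<in> \<Union>K" for v
    unfolding eq[OF that] using nonneg[OF u(2), of v] \<rho>_less_1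
    by (simp add: distrib_left mult_left_le_one_le \<rho>_pos less_imp_le)
  then have le': "u' v + u' (\<rho> *\<^sub>R v) \<le> u (\<rho> *\<^sub>R v)" if "v \<in> \<Union>K" for v
    using that \<rho>_pos by simp
  have "(\<Sum>v\<in>\<Union>K. u' v + u' (\<rho> *\<^sub>R v)) = 1"
    using total_mass[OF u(2)] prism_type_origin[OF type(2)] by simp
  moreover have "u 0 + (\<Sum>v\<in>\<Union>K. u (\<rho> *\<^sub>R v)) = 1"
  proof -
    have "(\<Sum>v\<in>\<Union>K. u v + u (\<rho> *\<^sub>R v)) = (\<Sum>v\<in>\<Union>K. u (\<rho> *\<^sub>R v))"
      using cone_type_outer[OF type(1)] by (intro sum.cong) simp_all
    then show ?thesis using total_mass[OF u(1)] by simp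
  qed
  moreover have "0 \<le> u 0" using nonneg[OF u(1)] .
  moreover have "(\<Sum>v\<in>\<Union>K. u' v + u' (\<rho> *\<^sub>R v)) \<le> (\<Sum>v\<in>\<Union>K. u (\<rho> *\<^sub>R v))"
    using le' by (rule sum_mono)
  ultimately have "u 0 = 0" by linarith
  have "u' (\<rho> *\<^sub>R v) \<le> u (\<rho> *\<^sub>R v)" if "v \<in> \<Union>K" for v
    using le'[OF that] nonneg[OF u(2), of v] by linarith
  then have "u' = u"
    by (intro ball_point_eqI_mono[OF u(2,1) rad[symmetric] prism_type_origin[OF type(2)] \<open>u 0 = 0\<close>])
  then show ?thesis by (rule sym)
qed

text \<open>\<open>cone_unique\<close> makes the radial coefficients equal. It remains to see that
  they are split alike between inner and outer vertices; two cone points do so because neither has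
  outer mass.\<close>

lemma inj_on_barycenter_ball: "inj_on barycenter (realization B)"
proof (rule inj_onI)
  fix u u' assume u: "u \<in> realization B" "u' \<in> realization B" and eq: "barycenter u = barycenter u'"
  have *: "\<exists>F\<in>facets K. {v. radial u v \<noteq> 0} \<subseteq> F" if "u \<in> realization B" for u
    using prism_or_cone_type[OF that] by (fastforce simp: radial_def prism_type_def cone_type_def)
  have nn: "0 \<le> radial u v" if "u \<in> realization B" for u v
    using nonneg[OF that] \<rho>_pos by (simp add: radial_def)
  obtain F F' where "F \<in> facets K" "F' \<in> facets K"
    "{v. radial u v \<noteq> 0} \<subseteq> F" "{v. radial u' v \<noteq> 0} \<subseteq> F'"
    using *[OF u(1)] *[OF u(2)] by blast
  then have rad: "radial u = radial u'"
    using eq nn u unfolding barycenter_radial[OF u(1)] barycenter_radial[OF u(2)]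
    by (intro cone_unique[of F F'])
  consider F w F' w' where "prism_type F w u" "prism_type F' w' u'"
    | F F' w' where "cone_type F u" "prism_type F' w' u'"
    | F F' w' where "cone_type F u'" "prism_type F' w' u"
    | F F' where "cone_type F u" "cone_type F' u'"
    using prism_or_cone_type[OF u(1)] prism_or_cone_type[OF u(2)] by metis
  then show "u = u'"
  proof cases
    case 1
    then show ?thesis by (rule inj_barycenter_prism[OF u rad])
  next
    case 2
    then show ?thesis by (rule inj_barycenter_cone[OF u rad])
  next
    case 3
    then show ?thesis by (rule inj_barycenter_cone[OF u(2,1) rad[symmetric], symmetric])
  next
    case 4
    show ?thesis
    proof (rule ball_point_eqI[OF u rad])
      fix v assume v: "v \<in> \<Union>K"
      then show "u (\<rho> *\<^sub>R v) = u' (\<rho> *\<^sub>R v)"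
        using fun_cong[OF rad, of v] cone_type_outer[OF 4(1) v] cone_type_outer[OF 4(2) v] \<rho>_pos
        by (simp add: radial_def)
    qed
  qed
qed

lemma geometric_ball: "geometric_complex B"
  by (rule geometric_complex.intro)
    (fact finite_ball_points ball_down_closed inj_on_barycenter_ball)+

lemma realization_mono: "realization K \<subseteq> realization B"
  using K_subset_ball by (auto simp: realization_def)

lemma geometric_boundary: "geometric_complex K"
  by (rule geometric_complex.intro)
    (fact finite_verts face_closed
      inj_on_subset[OF inj_on_barycenter_ball realization_mono])+

end

sublocale oriented_fan \<subseteq> ball: geometric_complex B
  by (rule geometric_ball)

sublocale oriented_fan \<subseteq> boundary: geometric_complex K
  by (rule geometric_boundary)

context oriented_fan
begin

lemma polyhedron_mono: "polyhedron_of K \<subseteq> polyhedron_of B"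
  using K_subset_ball by (auto simp: polyhedron_of_def)

lemma barycentric_coords_boundary:
  assumes "x \<in> polyhedron_of K"
  shows "barycentric_coords B x = barycentric_coords K x"
  using ball.barycentric_coords_barycenter[of "barycentric_coords K x"] realization_mono
    boundary.barycentric_coords_in[OF assms] boundary.barycenter_barycentric_coords[OF assms]
  by auto

lemma layered_cone:
  assumes L: "finite_simplicial_complex L" and g: "simplicial_map K L g"
  shows "layered_complex (facets K) (\<Union>K) R (Inr 0) (\<lambda>v. Inr (\<rho> *\<^sub>R v)) (\<lambda>v. Inl (g v))
           (simplicial_mapping_cone L K g B) ((`) Inl ` L)"
proof (rule layered_complex.intro)
  let ?cv = "cone_vertex K g"
  have cv_K: "?cv v = Inl (g v)" if "v \<in> \<Union>K" for v
    using that by (simp add: cone_vertex_def)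
  have cv_inn: "?cv (\<rho> *\<^sub>R v) = Inr (\<rho> *\<^sub>R v)" if "v \<in> \<Union>K" for v
    using scaled_notin[OF that] by (simp add: cone_vertex_def)
  have cv_0: "?cv 0 = Inr 0"
    using zero_notin by (simp add: cone_vertex_def)
  have prism: "?cv ` prism_simplex \<rho> R F w =
      (\<lambda>v. Inr (\<rho> *\<^sub>R v)) ` {v \<in> F. (w, v) \<in> R\<^sup>=} \<union> (\<lambda>v. Inl (g v)) ` {v \<in> F. (v, w) \<in> R\<^sup>=}"
    if "F \<in> facets K" for F w
    unfolding prism_simplex_def image_Un image_image
    using facet_subset[OF that] cv_K cv_inn by (intro arg_cong2[where f="(\<union>)"] image_cong) blast+
  have cone: "?cv ` insert 0 ((\<lambda>v. \<rho> *\<^sub>R v) ` F) = insert (Inr 0) ((\<lambda>v. Inr (\<rho> *\<^sub>R v)) ` F)"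
    if "F \<in> facets K" for F
    unfolding image_insert image_image cv_0
    using facet_subset[OF that] cv_inn by (intro arg_cong2[where f=insert] image_cong) blast+
  \<comment> \<open>A subset of an image is the image of a subset, so faces of image simplices are
    images of faces even where \<open>g\<close> collapses.\<close>
  have in_cone: "s \<in> simplicial_mapping_cone L K g B"
    if "\<And>t. t \<subseteq> T \<Longrightarrow> t \<noteq> {} \<Longrightarrow> t \<in> B" "s \<subseteq> ?cv ` T" "s \<noteq> {}" for s T
  proof -
    obtain t where "t \<subseteq> T" "s = ?cv ` t" using \<open>s \<subseteq> ?cv ` T\<close> by (meson subset_image_iff)
    with that(1,3) show ?thesis unfolding simplicial_mapping_cone_def by blast
  qed
  show "\<exists>F\<in>facets K.
      (\<exists>w\<in>F. s \<subseteq> (\<lambda>v. Inr (\<rho> *\<^sub>R v)) ` {v \<in> F. (w, v) \<in> R\<^sup>=} \<union> (\<lambda>v. Inl (g v)) ` {v \<in> F. (v, w) \<in> R\<^sup>=}) \<or>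
      s \<subseteq> insert (Inr 0) ((\<lambda>v. Inr (\<rho> *\<^sub>R v)) ` F)"
    if s: "s \<in> simplicial_mapping_cone L K g B" "s \<notin> (`) Inl ` L" for s
  proof -
    obtain t where t: "t \<in> B" "s = ?cv ` t"
      using s unfolding simplicial_mapping_cone_def by blast
    obtain F where F: "F \<in> facets K" and
      "(\<exists>w\<in>F. t \<subseteq> prism_simplex \<rho> R F w) \<or> t \<subseteq> insert 0 ((\<lambda>v. \<rho> *\<^sub>R v) ` F)"
      using ball_cases[OF t(1)] by (rule bexE)
    then have "(\<exists>w\<in>F. s \<subseteq> ?cv ` prism_simplex \<rho> R F w) \<or> s \<subseteq> ?cv ` insert 0 ((\<lambda>v. \<rho> *\<^sub>R v) ` F)"
      unfolding t(2) by (meson image_mono)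
    then show ?thesis unfolding prism[OF F] cone[OF F] using F by (rule bexI)
  qed
  show "s \<in> simplicial_mapping_cone L K g B" if "F \<in> facets K" "w \<in> F"
    "s \<subseteq> (\<lambda>v. Inr (\<rho> *\<^sub>R v)) ` {v \<in> F. (w, v) \<in> R\<^sup>=} \<union> (\<lambda>v. Inl (g v)) ` {v \<in> F. (v, w) \<in> R\<^sup>=}"
    "s \<noteq> {}" for F w s
    using that(3,4) unfolding prism[OF that(1), symmetric]
    by (rule in_cone[rotated]) (rule prism_in_ball[OF that(1,2)])
  show "s \<in> simplicial_mapping_cone L K g B" if "F \<in> facets K"
    "s \<subseteq> insert (Inr 0) ((\<lambda>v. Inr (\<rho> *\<^sub>R v)) ` F)" "s \<noteq> {}" for F s
    using that(2,3) unfolding cone[OF that(1), symmetric]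
    by (rule in_cone[rotated]) (rule cone_in_ball[OF that(1)])
  have "finite (\<Union>L)" using L by (simp add: finite_simplicial_complex_def)
  moreover have "\<Union>(simplicial_mapping_cone L K g B) = Inl ` \<Union>L \<union> ?cv ` \<Union>B"
    unfolding simplicial_mapping_cone_def by blast
  ultimately show "finite (\<Union>(simplicial_mapping_cone L K g B))"
    using finite_ball_points by simp
  show "(`) Inl ` L \<subseteq> simplicial_mapping_cone L K g B"
    unfolding simplicial_mapping_cone_def by blast
  show "Inr 0 \<notin> s \<and> (\<lambda>v. Inr (\<rho> *\<^sub>R v)) ` \<Union>K \<inter> s = {}" if "s \<in> (`) Inl ` L" for s
    using that by blast
  show "(\<lambda>v. Inl (g v)) ` s \<in> (`) Inl ` L" if "F \<in> facets K" "s \<subseteq> F" "s \<noteq> {}" for F s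
  proof -
    have "g ` s \<in> L"
      using g face_closed[OF facet_in[OF that(1)] that(2,3)] by (simp add: simplicial_map_def)
    then show ?thesis unfolding image_image[symmetric, of Inl g] by (rule imageI)
  qed
  show "inj_on (\<lambda>v. Inr (\<rho> *\<^sub>R v)) (\<Union>K)" using ball.inj_inn by (simp add: inj_on_def)
  show "Inr (\<rho> *\<^sub>R v) \<noteq> Inr 0" if "v \<in> \<Union>K" for v using ball.inn_neq_org[OF that] by simp
qed ((fact ball.facet_nonempty ball.vertices finite_verts facet_total acyclic_orientation
    irrefl_orientation | rule Inl_not_Inr)+)

end

subsection \<open>Maps and homotopies on adjunction spaces\<close>

text \<open>Coordinates are nonnegative, so nothing cancels in the fibre sums and the support of the
  image is the image of the support.\<close>

lemma realization_map_in:
  assumes u: "u \<in> realization C" and fin: "finite {v. u v \<noteq> 0}" and f: "simplicial_map C D f"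
  shows "realization_map f u \<in> realization D"
proof -
  have nn: "\<And>v. 0 \<le> u v" and supp: "{v. u v \<noteq> 0} \<in> C" and sum1: "sum u {v. u v \<noteq> 0} = 1"
    using u by (auto simp: realization_def)
  have ne: "realization_map f u w \<noteq> 0 \<longleftrightarrow> w \<in> f ` {v. u v \<noteq> 0}" for w
  proof -
    have "realization_map f u w = 0 \<longleftrightarrow> (\<forall>v\<in>{v. u v \<noteq> 0 \<and> f v = w}. u v = 0)"
      unfolding realization_map_def using nn fin by (intro sum_nonneg_eq_0_iff) auto
    then show ?thesis by auto
  qed
  then have "{w. realization_map f u w \<noteq> 0} = f ` {v. u v \<noteq> 0}" by auto
  moreover have "f ` {v. u v \<noteq> 0} \<in> D" using f supp by (simp add: simplicial_map_def)
  moreover have "sum (realization_map f u) (f ` {v. u v \<noteq> 0}) = 1"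
    using sum.group[OF fin finite_imageI[OF fin] subset_refl, of u] sum1
    by (simp add: realization_map_def)
  ultimately show ?thesis
    using nn by (simp add: realization_def) (simp add: realization_map_def sum_nonneg)
qed

lemma realization_map_cong:
  "(\<And>v. u v \<noteq> 0 \<Longrightarrow> f v = g v) \<Longrightarrow> realization_map f u = realization_map g u"
  unfolding realization_map_def by (intro ext sum.cong) auto

lemma realization_map_apply:
  assumes "\<And>x. u x \<noteq> 0 \<Longrightarrow> f x = f v \<Longrightarrow> x = v"
  shows "realization_map f u (f v) = u v"
proof -
  have "{x. u x \<noteq> 0 \<and> f x = f v} = (if u v = 0 then {} else {v})" using assms by auto
  then show ?thesis unfolding realization_map_def by simp
qed

lemma realization_map_outside:
  assumes "\<And>v. u v \<noteq> 0 \<Longrightarrow> f v \<noteq> w"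
  shows "realization_map f u w = 0"
proof -
  have "{v. u v \<noteq> 0 \<and> f v = w} = {}" using assms by auto
  then show ?thesis unfolding realization_map_def by (simp del: Collect_empty_eq)
qed

lemma realization_map_inj_comp:
  assumes "inj h"
  shows "realization_map h (realization_map k u) = realization_map (h \<circ> k) u"
proof
  fix w
  show "realization_map h (realization_map k u) w = realization_map (h \<circ> k) u w"
  proof (cases "w \<in> range h")
    case True
    then obtain x where x: "w = h x" by auto
    have "realization_map h (realization_map k u) (h x) = realization_map k u x"
      using assms by (intro realization_map_apply) (auto dest: injD)
    also have "\<dots> = realization_map (h \<circ> k) u (h x)"
      using assms by (simp add: realization_map_def inj_eq)
    finally show ?thesis using x by simp
  next
    case False
    then show ?thesis by (subst (1 2) realization_map_outside) auto
  qed
qed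

lemma continuous_on_realization_map:
  assumes "finite (\<Union>C)"
  shows "continuous_on (realization C) (realization_map f)"
proof (rule continuous_on_coordinatewise_then_product)
  fix w
  have "continuous_on (realization C) (\<lambda>u. \<Sum>v | v \<in> \<Union>C \<and> f v = w. u v)"
    by (intro continuous_intros continuous_on_product_then_coordinatewise[OF continuous_on_id])
  then show "continuous_on (realization C) (\<lambda>u. realization_map f u w)"
  proof (rule continuous_on_eq)
    fix u assume "u \<in> realization C"
    then have "{v. u v \<noteq> 0} \<subseteq> \<Union>C" by (auto simp: realization_def)
    then show "(\<Sum>v | v \<in> \<Union>C \<and> f v = w. u v) = realization_map f u w"
      unfolding realization_map_def using finite_subset[OF _ assms, of "{v. v \<in> \<Union>C \<and> f v = w}"]
      by (intro sum.mono_neutral_right) auto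
  qed
qed

section \<open>Disjoint sums and their products with a space\<close>

lemma continuous_map_from_disjoint_sum:
  assumes "continuous_map X Z (h \<circ> Inl)" "continuous_map Y Z (h \<circ> Inr)"
  shows "continuous_map (disjoint_sum_topology X Y) Z h"
  unfolding continuous_map_def
proof (intro conjI allI impI)
  show "h \<in> topspace (disjoint_sum_topology X Y) \<rightarrow> topspace Z"
    using assms by (auto simp: continuous_map_def)
  fix U assume "openin Z U"
  then have "openin X {x \<in> topspace X. (h \<circ> Inl) x \<in> U}" "openin Y {y \<in> topspace Y. (h \<circ> Inr) y \<in> U}"
    using assms by (auto simp: continuous_map_def)
  moreover have "Inl -` {z \<in> topspace (disjoint_sum_topology X Y). h z \<in> U} = {x \<in> topspace X. (h \<circ> Inl) x \<in> U}"
    "Inr -` {z \<in> topspace (disjoint_sum_topology X Y). h z \<in> U} = {y \<in> topspace Y. (h \<circ> Inr) y \<in> U}"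
    by auto
  ultimately show "openin (disjoint_sum_topology X Y) {z \<in> topspace (disjoint_sum_topology X Y). h z \<in> U}"
    unfolding openin_disjoint_sum_topology by simp
qed

lemma continuous_map_Inl: "continuous_map X (disjoint_sum_topology X Y) Inl"
proof -
  have "{x \<in> topspace X. Inl x \<in> U} = Inl -` U"
    if "openin (disjoint_sum_topology X Y) U" for U :: "('a + 'b) set"
    using that openin_subset[of X "Inl -` U"] by (auto simp: openin_disjoint_sum_topology)
  then show ?thesis by (auto simp: continuous_map_def openin_disjoint_sum_topology)
qed

lemma continuous_map_Inr: "continuous_map Y (disjoint_sum_topology X Y) Inr"
proof -
  have "{x \<in> topspace Y. Inr x \<in> U} = Inr -` U"
    if "openin (disjoint_sum_topology X Y) U" for U :: "('b + 'a) set"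
    using that openin_subset[of Y "Inr -` U"] by (auto simp: openin_disjoint_sum_topology)
  then show ?thesis by (auto simp: continuous_map_def openin_disjoint_sum_topology)
qed

lemma openin_Inl_image: "openin X V \<Longrightarrow> openin (disjoint_sum_topology X Y) (Inl ` V)"
  and openin_Inr_image: "openin Y W \<Longrightarrow> openin (disjoint_sum_topology X Y) (Inr ` W)"
proof -
  have "Inr -` Inl ` V = ({} :: 'b set)" for V :: "'a set" by auto
  then show "openin X V \<Longrightarrow> openin (disjoint_sum_topology X Y) (Inl ` V)"
    by (simp add: openin_disjoint_sum_topology inj_vimage_image_eq)
  have "Inl -` Inr ` W = ({} :: 'a set)" for W :: "'b set" by auto
  then show "openin Y W \<Longrightarrow> openin (disjoint_sum_topology X Y) (Inr ` W)"
    by (simp add: openin_disjoint_sum_topology inj_vimage_image_eq)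
qed

text \<open>Products distribute over disjoint sums: both injections are open, so a box around a
  point can be chosen within one summand. This allows a homotopy on the sum to be given on each
  summand.\<close>

lemma continuous_map_from_prod_disjoint_sum:
  assumes l: "continuous_map (prod_topology T X) Z (\<lambda>(t, x). h (t, Inl x))"
    and r: "continuous_map (prod_topology T Y) Z (\<lambda>(t, y). h (t, Inr y))"
  shows "continuous_map (prod_topology T (disjoint_sum_topology X Y)) Z h"
  unfolding continuous_map_def
proof (intro conjI allI impI)
  let ?S = "prod_topology T (disjoint_sum_topology X Y)"
  show "h \<in> topspace ?S \<rightarrow> topspace Z"
  proof
    fix p assume p: "p \<in> topspace ?S"
    then obtain t z where tz: "p = (t, z)" "t \<in> topspace T" "z \<in> topspace X <+> topspace Y"
      by (cases p) auto
    from tz(3) show "h p \<in> topspace Z"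
    proof (elim PlusE)
      fix x assume "x \<in> topspace X" "z = Inl x"
      with tz show ?thesis using Pi_mem[OF continuous_map_funspace[OF l], of "(t, x)"] by simp
    next
      fix x assume "x \<in> topspace Y" "z = Inr x"
      with tz show ?thesis using Pi_mem[OF continuous_map_funspace[OF r], of "(t, x)"] by simp
    qed
  qed
  fix U assume U: "openin Z U"
  show "openin ?S {p \<in> topspace ?S. h p \<in> U}"
    unfolding openin_prod_topology_alt
  proof (intro allI impI)
    fix t z assume tz: "(t, z) \<in> {p \<in> topspace ?S. h p \<in> U}"
    show "\<exists>A W. openin T A \<and> openin (disjoint_sum_topology X Y) W \<and> t \<in> A \<and> z \<in> W \<and>
                A \<times> W \<subseteq> {p \<in> topspace ?S. h p \<in> U}"
    proof (cases z)
      case (Inl x)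
      let ?P = "{p \<in> topspace (prod_topology T X). (\<lambda>(t, x). h (t, Inl x)) p \<in> U}"
      have "openin (prod_topology T X) ?P" using l U by (simp add: continuous_map_def)
      moreover have "(t, x) \<in> ?P" using tz Inl by auto
      ultimately obtain A W where AW: "openin T A" "openin X W" "t \<in> A" "x \<in> W" "A \<times> W \<subseteq> ?P"
        unfolding openin_prod_topology_alt by meson
      have "A \<times> Inl ` W \<subseteq> {p \<in> topspace ?S. h p \<in> U}" using AW(5) by fastforce
      with AW Inl openin_Inl_image[OF AW(2)] show ?thesis by blast
    next
      case (Inr x)
      let ?P = "{p \<in> topspace (prod_topology T Y). (\<lambda>(t, y). h (t, Inr y)) p \<in> U}"
      have "openin (prod_topology T Y) ?P" using r U by (simp add: continuous_map_def)
      moreover have "(t, x) \<in> ?P" using tz Inr by auto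
      ultimately obtain A W where AW: "openin T A" "openin Y W" "t \<in> A" "x \<in> W" "A \<times> W \<subseteq> ?P"
        unfolding openin_prod_topology_alt by meson
      have "A \<times> Inr ` W \<subseteq> {p \<in> topspace ?S. h p \<in> U}" using AW(5) by fastforce
      with AW Inr openin_Inr_image[OF AW(2)] show ?thesis by blast
    qed
  qed
qed

section \<open>Quotients and adjunction spaces\<close>

lemma quotient_map_quotient_topology:
  assumes equiv: "equiv UNIV r" and sat: "r `` topspace X \<subseteq> topspace X"
  shows "quotient_map X (quotient_topology X r) (\<lambda>x. r `` {x})"
proof -
  have Un: "\<Union>U = {x \<in> topspace X. r `` {x} \<in> U}" if U: "U \<subseteq> topspace X // r" for U
  proof (intro equalityI subsetI)
    fix x assume "x \<in> \<Union>U"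
    then obtain c where c: "c \<in> U" "x \<in> c" by auto
    then obtain y where y: "y \<in> topspace X" "c = r `` {y}" using U by (auto simp: quotient_def)
    then have "(y, x) \<in> r" using c by auto
    then have "r `` {x} = c" using y equiv_class_eq[OF equiv] by auto
    moreover have "x \<in> topspace X" using \<open>(y, x) \<in> r\<close> y sat by blast
    ultimately show "x \<in> {x \<in> topspace X. r `` {x} \<in> U}" using c by simp
  next
    fix x assume "x \<in> {x \<in> topspace X. r `` {x} \<in> U}"
    moreover have "x \<in> r `` {x}" using equiv by (auto dest: equiv_class_self)
    ultimately show "x \<in> \<Union>U" by auto
  qed
  have open_iff: "openin (quotient_topology X r) U \<longleftrightarrow> openin X {x \<in> topspace X. r `` {x} \<in> U}"
    if "U \<subseteq> topspace X // r" for U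
    using openin_quotient_topology[OF equiv, of X U] Un[OF that] that by simp
  have "topspace (quotient_topology X r) = topspace X // r"
  proof
    show "topspace (quotient_topology X r) \<subseteq> topspace X // r"
      using openin_topspace[of "quotient_topology X r"] openin_quotient_topology[OF equiv] by blast
    have "{x \<in> topspace X. r `` {x} \<in> topspace X // r} = topspace X" by (auto intro: quotientI)
    then have "openin (quotient_topology X r) (topspace X // r)"
      using open_iff[OF subset_refl] by simp
    then show "topspace X // r \<subseteq> topspace (quotient_topology X r)" by (rule openin_subset)
  qed
  moreover have "(\<lambda>x. r `` {x}) ` topspace X = topspace X // r" by (auto simp: quotient_def)
  ultimately show ?thesis
    unfolding quotient_map_def using open_iff by simp
qed

definition glue :: "'b set \<Rightarrow> ('b \<Rightarrow> 'a) \<Rightarrow> 'a + 'b \<Rightarrow> ('a + 'b) set" where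
  "glue A f x = gluing_relation A f `` {x}"

text \<open>Induction along a zigzag of elementary identifications. With a truth-valued
  \<open>\<phi>\<close> it also shows that the carrier is a union of classes.\<close>

lemma gluing_relation_invariant:
  assumes rel: "(x, y) \<in> gluing_relation A f"
    and inv: "\<And>a. a \<in> A \<Longrightarrow> \<phi> (Inr a) = \<phi> (Inl (f a))"
  shows "\<phi> x = \<phi> y"
  using rel unfolding gluing_relation_def Let_def
proof (induction rule: rtrancl_induct)
  case (step y z)
  then show ?case using inv by auto
qed simp

lemma glue_eq: "a \<in> A \<Longrightarrow> glue A f (Inr a) = glue A f (Inl (f a))"
proof -
  assume "a \<in> A"
  then have "(Inr a, Inl (f a)) \<in> gluing_relation A f"
    unfolding gluing_relation_def Let_def by blast
  then show ?thesis
    unfolding glue_def by (rule equiv_class_eq[OF equiv_gluing_relation])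
qed

lemma the_elem_glue:
  assumes "\<And>a. a \<in> A \<Longrightarrow> \<phi> (Inr a) = \<phi> (Inl (f a))"
  shows "the_elem (\<phi> ` glue A f x) = \<phi> x"
proof -
  have "x \<in> glue A f x"
    unfolding glue_def using equiv_gluing_relation[of A f] by (auto dest: equiv_class_self)
  moreover have "\<phi> y = \<phi> x" if "y \<in> glue A f x" for y
    using gluing_relation_invariant[of x y A f \<phi>] that assms by (simp add: glue_def)
  ultimately have "\<phi> ` glue A f x = {\<phi> x}" by blast
  then show ?thesis by simp
qed

lemma quotient_map_glue:
  assumes "A \<subseteq> topspace Y" "f ` A \<subseteq> topspace X"
  shows "quotient_map (disjoint_sum_topology X Y) (adjunction_space X Y A f) (glue A f)"
proof -
  let ?S = "disjoint_sum_topology X Y"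
  have "gluing_relation A f `` topspace ?S \<subseteq> topspace ?S"
  proof
    fix y assume "y \<in> gluing_relation A f `` topspace ?S"
    then obtain x where x: "x \<in> topspace ?S" "(x, y) \<in> gluing_relation A f" by (rule ImageE)
    have "(Inr a \<in> topspace ?S) = (Inl (f a) \<in> topspace ?S)" if "a \<in> A" for a
      using that assms by (simp add: Plus_def image_subset_iff subset_iff)
    from gluing_relation_invariant[where \<phi>="\<lambda>z. z \<in> topspace ?S", OF x(2) this] x(1)
    show "y \<in> topspace ?S" by simp
  qed
  from quotient_map_quotient_topology[OF equiv_gluing_relation this] show ?thesis
    by (simp add: adjunction_space_def glue_def[abs_def])
qed

text \<open>The interval is locally compact and Hausdorff, so its product with the gluing map is
  again a quotient map. A family of maps compatible with the gluing at every time thus descends to a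
  continuous homotopy.\<close>

lemma homotopic_with_adjunction_space:
  assumes A: "A \<subseteq> topspace Y" "f ` A \<subseteq> topspace X"
    and l: "continuous_map (prod_topology (top_of_set {0..1::real}) X) Z (\<lambda>(t, x). h t (Inl x))"
    and r: "continuous_map (prod_topology (top_of_set {0..1::real}) Y) Z (\<lambda>(t, y). h t (Inr y))"
    and inv: "\<And>t a. t \<in> {0..1} \<Longrightarrow> a \<in> A \<Longrightarrow> h t (Inr a) = h t (Inl (f a))"
    and h0: "\<And>x. x \<in> topspace (disjoint_sum_topology X Y) \<Longrightarrow> k (glue A f x) = h 0 x"
    and h1: "\<And>x. x \<in> topspace (disjoint_sum_topology X Y) \<Longrightarrow> k' (glue A f x) = h 1 x"
  shows "homotopic_with (\<lambda>_. True) (adjunction_space X Y A f) Z k k'"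
proof -
  define H where "H = (\<lambda>(t, c). the_elem (h t ` c))"
  have H: "H (t, glue A f x) = h t x" if "t \<in> {0..1}" for t x
    unfolding H_def using the_elem_glue[of A "h t" f x] inv[OF that] by simp
  let ?S = "disjoint_sum_topology X Y" and ?I = "top_of_set {0..1::real}"
  have "quotient_map (prod_topology ?I ?S) (prod_topology ?I (adjunction_space X Y A f))
      (\<lambda>(t, x). (t, glue A f x))"
    by (intro quotient_map_prod_right quotient_map_glue A disjI1 compact_imp_locally_compact_space
        compact_space_subtopology Hausdorff_space_subtopology)
       (auto simp: compact_space_subtopology)
  moreover have "continuous_map (prod_topology ?I ?S) Z (H \<circ> (\<lambda>(t, x). (t, glue A f x)))"
  proof (rule continuous_map_eq)
    show "continuous_map (prod_topology ?I ?S) Z (\<lambda>(t, x). h t x)"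
      using l r by (intro continuous_map_from_prod_disjoint_sum) (simp_all add: case_prod_unfold)
  qed (use H in auto)
  ultimately have "continuous_map (prod_topology ?I (adjunction_space X Y A f)) Z H"
    by (rule continuous_compose_quotient_map)
  then have "homotopic_with (\<lambda>_. True) (adjunction_space X Y A f) Z (\<lambda>c. H (0, c)) (\<lambda>c. H (1, c))"
    unfolding homotopic_with_def by (intro exI[of _ H]) simp
  then show ?thesis
  proof (rule homotopic_with_eq)
    have surj: "topspace (adjunction_space X Y A f) = glue A f ` topspace ?S"
      using quotient_imp_surjective_map[OF quotient_map_glue[OF A]] by simp
    fix c assume "c \<in> topspace (adjunction_space X Y A f)"
    then obtain x where x: "c = glue A f x" "x \<in> topspace ?S" unfolding surj by (rule imageE)
    show "k c = H (0, c)" "k' c = H (1, c)"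
      using H h0[OF x(2)] h1[OF x(2)] by (simp_all add: x(1))
  qed simp
qed

subsection \<open>The homotopy inverse\<close>

locale fan_map = oriented_fan K \<rho> R
  for K :: "'a::euclidean_space set set" and \<rho> :: real and R :: "('a \<times> 'a) set" +
  fixes L :: "'v set set" and g :: "'a \<Rightarrow> 'v"
  assumes complex_L: "finite_simplicial_complex L"
    and simplicial_g: "simplicial_map K L g"

sublocale fan_map \<subseteq> cone: layered_complex "facets K" "\<Union>K" R "Inr 0" "\<lambda>v. Inr (\<rho> *\<^sub>R v)"
  "\<lambda>v. Inl (g v)" "simplicial_mapping_cone L K g B" "(`) Inl ` L"
  by (rule layered_cone[OF complex_L simplicial_g])

context fan_map
begin

abbreviation M where "M \<equiv> simplicial_mapping_cone L K g B"
abbreviation cv where "cv \<equiv> cone_vertex K g"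
abbreviation attach where "attach \<equiv> polyhedron_map K g"
abbreviation proj where "proj \<equiv> glue (polyhedron_of K) attach"
abbreviation cone_space where "cone_space \<equiv> topological_mapping_cone L K g B"
abbreviation unglued where
  "unglued \<equiv> disjoint_sum_topology (realization_space L) (top_of_set (polyhedron_of B))"

section \<open>The vertex identification and the induced map\<close>

lemma cv_outer: "v \<in> \<Union>K \<Longrightarrow> cv v = Inl (g v)"
  and cv_not_outer: "v \<notin> \<Union>K \<Longrightarrow> cv v = Inr v"
  by (simp_all add: cone_vertex_def)

lemma cv_eq_Inr: "cv x = Inr y \<longleftrightarrow> x = y \<and> x \<notin> \<Union>K"
  by (auto simp: cone_vertex_def)

lemma finite_support_ball: "u \<in> realization B \<Longrightarrow> finite {v. u v \<noteq> 0}"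
  using finite_subset[OF support_ball finite_ball_points] .

lemma simplicial_cv: "simplicial_map B M cv"
  by (simp add: simplicial_map_def simplicial_mapping_cone_def)

lemma realization_map_cv_in: "u \<in> realization B \<Longrightarrow> realization_map cv u \<in> realization M"
  using realization_map_in[OF _ finite_support_ball simplicial_cv] by blast

lemma finite_support_L: "u \<in> realization L \<Longrightarrow> finite {v. u v \<noteq> 0}"
  using complex_L by (auto simp: finite_simplicial_complex_def realization_def)

lemma realization_map_Inl_in: "u \<in> realization L \<Longrightarrow> realization_map Inl u \<in> realization ((`) Inl ` L)"
  by (rule realization_map_in[OF _ finite_support_L]) (auto simp: simplicial_map_def)

lemma realization_base_subset: "realization ((`) Inl ` L) \<subseteq> realization M"
  using cone.base_subset by (auto simp: realization_def)

lemma realization_map_Inl_apply [simp]: "realization_map Inl u (Inl w) = u w"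
  by (rule realization_map_apply) simp

lemma attach_barycenter:
  "u \<in> realization K \<Longrightarrow> attach (barycenter u) = realization_map g u"
  by (simp add: polyhedron_map_def boundary.barycentric_coords_barycenter)

lemma attach_in: "attach ` polyhedron_of K \<subseteq> realization L"
proof (rule image_subsetI)
  fix x assume "x \<in> polyhedron_of K"
  then have "barycentric_coords K x \<in> realization K" by (rule boundary.barycentric_coords_in)
  then show "attach x \<in> realization L"
    unfolding polyhedron_map_def
    using realization_mono finite_support_ball by (intro realization_map_in[OF _ _ simplicial_g]) auto
qed

lemma realization_map_cv_boundary:
  assumes "u \<in> realization K"
  shows "realization_map cv u = realization_map Inl (realization_map g u)"
proof -
  have "{v. u v \<noteq> 0} \<subseteq> \<Union>K" using assms by (auto simp: realization_def)
  then have "realization_map cv u = realization_map (Inl \<circ> g) u"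
    by (intro realization_map_cong) (auto intro!: cv_outer)
  then show ?thesis by (simp add: realization_map_inj_comp)
qed

lemma quotient_map_proj: "quotient_map unglued cone_space proj"
  unfolding topological_mapping_cone_def
  using polyhedron_mono attach_in by (intro quotient_map_glue) (simp_all add: realization_space_def)

definition unglued_map :: "('v \<Rightarrow> real) + 'a \<Rightarrow> 'v + 'a \<Rightarrow> real" where
  "unglued_map = case_sum (realization_map Inl) (polyhedron_map B cv)"

lemma cone_quotient_map_proj: "cone_quotient_map K g B (proj x) = unglued_map x"
  unfolding cone_quotient_map_def unglued_map_def
proof (rule the_elem_glue)
  fix a assume a: "a \<in> polyhedron_of K"
  then show "case_sum (realization_map Inl) (polyhedron_map B cv) (Inr a) =
      case_sum (realization_map Inl) (polyhedron_map B cv) (Inl (attach a))"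
    using realization_map_cv_boundary[OF boundary.barycentric_coords_in[OF a]]
    by (simp add: polyhedron_map_def barycentric_coords_boundary)
qed

lemma continuous_unglued_map: "continuous_map unglued (realization_space M) unglued_map"
proof (rule continuous_map_from_disjoint_sum)
  have "finite (\<Union>L)" using complex_L by (simp add: finite_simplicial_complex_def)
  then show "continuous_map (realization_space L) (realization_space M) (unglued_map \<circ> Inl)"
    using realization_map_Inl_in realization_base_subset
    by (auto simp: realization_space_def unglued_map_def comp_def continuous_on_realization_map)
  have "continuous_on (polyhedron_of B) (\<lambda>x. realization_map cv (barycentric_coords B x))"
    using continuous_on_realization_map[OF finite_ball_points] ball.continuous_barycentric_coords
    by (rule continuous_on_compose2) (auto intro: ball.barycentric_coords_in)
  then show "continuous_map (top_of_set (polyhedron_of B)) (realization_space M) (unglued_map \<circ> Inr)"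
    using realization_map_cv_in ball.barycentric_coords_in
    by (auto simp: realization_space_def unglued_map_def comp_def polyhedron_map_def)
qed

lemma continuous_cone_quotient_map:
  "continuous_map cone_space (realization_space M) (cone_quotient_map K g B)"
  using continuous_unglued_map
  by (intro continuous_compose_quotient_map[OF quotient_map_proj])
     (simp add: comp_def cone_quotient_map_proj)

text \<open>\<open>cv\<close> identifies only outer vertices; the origin and the inner vertices keep
  unique preimages, as the naturality of the flow requires.\<close>

lemma realization_map_cv_flow:
  assumes "u \<in> realization B" "0 \<le> t"
  shows "realization_map cv (ball.flow t u) = cone.flow t (realization_map cv u)"
proof (rule realization_map_flow[OF layered_ball layered_cone[OF complex_L simplicial_g] _ _ _ _ assms])
  show "facets K \<noteq> {}" using K_nonempty in_facet by blast
  show "cv w = Inr 0 \<longleftrightarrow> w = 0" for w using zero_notin by (auto simp: cv_eq_Inr)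
  show "cv w = Inr (\<rho> *\<^sub>R v) \<longleftrightarrow> w = \<rho> *\<^sub>R v" if "v \<in> \<Union>K" for v w
    using scaled_notin[OF that] by (auto simp: cv_eq_Inr)
qed (rule cv_outer)

section \<open>Construction of the inverse\<close>

text \<open>At time 1 a point without origin mass has reached the outer layer, where gluing replaces
  it by its image in \<open>L\<close>. This is the agreement of the two branches of
  \<open>inverse_map\<close>.\<close>

lemma proj_flow_prism:
  assumes u: "u \<in> realization B" "u 0 = 0"
  shows "proj (Inr (barycenter (ball.flow 1 u))) =
         proj (Inl (\<lambda>w. cone.flow 1 (realization_map cv u) (Inl w)))"
proof -
  have K: "ball.flow 1 u \<in> realization K" by (rule ball.flow_1_in_base[OF u])
  then have "barycenter (ball.flow 1 u) \<in> polyhedron_of K"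
    using boundary.barycenter_image by blast
  then have "proj (Inr (barycenter (ball.flow 1 u))) = proj (Inl (realization_map g (ball.flow 1 u)))"
    using glue_eq[of _ "polyhedron_of K" attach] attach_barycenter[OF K] by simp
  moreover have "cone.flow 1 (realization_map cv u) = realization_map Inl (realization_map g (ball.flow 1 u))"
    using realization_map_cv_flow[OF u(1)] realization_map_cv_boundary[OF K] by simp
  ultimately show ?thesis by simp
qed

lemma base_restrict:
  assumes "z \<in> realization ((`) Inl ` L)"
  shows "(\<lambda>w. z (Inl w)) \<in> realization L" "realization_map Inl (\<lambda>w. z (Inl w)) = z"
proof -
  obtain s where s: "s \<in> L" "{x. z x \<noteq> 0} = Inl ` s" using assms by (auto simp: realization_def)
  have supp: "{w. z (Inl w) \<noteq> 0} = s" using s(2) by auto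
  have "sum z (Inl ` s) = 1" using assms s(2) by (simp add: realization_def)
  then have "(\<Sum>w\<in>s. z (Inl w)) = 1" by (simp add: sum.reindex)
  with s supp assms show "(\<lambda>w. z (Inl w)) \<in> realization L" by (simp add: realization_def)
  show "realization_map Inl (\<lambda>w. z (Inl w)) = z"
  proof
    fix x show "realization_map Inl (\<lambda>w. z (Inl w)) x = z x"
    proof (cases x)
      case (Inr y)
      then have "z x = 0" using s(2) by auto
      with Inr show ?thesis by (simp add: realization_map_outside)
    qed simp
  qed
qed

text \<open>A support without vertices of \<open>L\<close> is the image of a simplex without outer
  vertices, and there \<open>cv\<close> is just \<open>Inr\<close>. So such points lift canonically
  to the ball.\<close>

lemma inner_restrict:
  assumes y: "y \<in> realization M" and zero: "\<And>w. y (Inl w) = 0"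
  shows "(\<lambda>x. y (Inr x)) \<in> realization B" "realization_map cv (\<lambda>x. y (Inr x)) = y"
proof -
  have "{x. y x \<noteq> 0} \<in> M" and sum1: "sum y {x. y x \<noteq> 0} = 1" and nn: "\<And>x. 0 \<le> y x"
    using y by (auto simp: realization_def)
  \<comment> \<open>The support avoids all \<open>Inl\<close> vertices, so it could be a simplex of
    \<open>L\<close> only if it were empty.\<close>
  moreover have "{x. y x \<noteq> 0} \<noteq> {}" using sum1 by (metis sum.empty zero_neq_one)
  then have "{x. y x \<noteq> 0} \<noteq> Inl ` s" for s using zero by blast
  ultimately obtain t where t: "t \<in> B" "{x. y x \<noteq> 0} = cv ` t"
    unfolding simplicial_mapping_cone_def by blast
  have inner: "x \<notin> \<Union>K" if "x \<in> t" for x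
  proof
    assume "x \<in> \<Union>K"
    then have "Inl (g x) \<in> {x. y x \<noteq> 0}" using t that cv_outer by (metis imageI)
    with zero show False by simp
  qed
  then have supp: "{x. y x \<noteq> 0} = Inr ` t"
    unfolding t(2) using cv_not_outer by (intro image_cong) auto
  then have supp': "{x. y (Inr x) \<noteq> 0} = t" by auto
  have "(\<Sum>x\<in>t. y (Inr x)) = 1" using sum1 unfolding supp by (simp add: sum.reindex)
  with t(1) nn supp' show "(\<lambda>x. y (Inr x)) \<in> realization B" by (simp add: realization_def)
  have "realization_map cv (\<lambda>x. y (Inr x)) = realization_map Inr (\<lambda>x. y (Inr x))"
    using supp' inner cv_not_outer by (intro realization_map_cong) blast
  also have "\<dots> = y"
  proof
    fix x show "realization_map Inr (\<lambda>x. y (Inr x)) x = y x"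
    proof (cases x)
      case (Inl w)
      then show ?thesis using zero by (simp add: realization_map_outside)
    next
      case (Inr w)
      have "realization_map Inr (\<lambda>x. y (Inr x)) (Inr w) = y (Inr w)"
        by (rule realization_map_apply) simp
      with Inr show ?thesis by simp
    qed
  qed
  finally show "realization_map cv (\<lambda>x. y (Inr x)) = y" .
qed

text \<open>No simplex of the mapping cone contains the origin together with a vertex of
  \<open>L\<close>. Hence points with origin mass lift to the ball.\<close>

lemma no_base_mass:
  assumes y: "y \<in> realization M" and "y (Inr 0) \<noteq> 0"
  shows "y (Inl w) = 0"
proof (rule ccontr)
  assume w: "y (Inl w) \<noteq> 0"
  have "{x. y x \<noteq> 0} \<in> M" using y by (simp add: realization_def)
  moreover have "{x. y x \<noteq> 0} \<notin> (`) Inl ` L" using assms(2) by blast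
  ultimately obtain F where F: "F \<in> facets K"
    "(\<exists>w\<in>F. {x. y x \<noteq> 0} \<subseteq> (\<lambda>v. Inr (\<rho> *\<^sub>R v)) ` {v \<in> F. (w, v) \<in> R\<^sup>=} \<union> (\<lambda>v. Inl (g v)) ` {v \<in> F. (v, w) \<in> R\<^sup>=}) \<or>
      {x. y x \<noteq> 0} \<subseteq> insert (Inr 0) ((\<lambda>v. Inr (\<rho> *\<^sub>R v)) ` F)"
    by (rule bexE[OF cone.simplex_cases])
  from F(2) show False
  proof (elim disjE bexE)
    fix w' assume "{x. y x \<noteq> 0} \<subseteq> (\<lambda>v. Inr (\<rho> *\<^sub>R v)) ` {v \<in> F. (w', v) \<in> R\<^sup>=} \<union> (\<lambda>v. Inl (g v)) ` {v \<in> F. (v, w') \<in> R\<^sup>=}"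
    then obtain v where "v \<in> F" "Inr 0 = (Inr (\<rho> *\<^sub>R v) :: 'v + 'a)" using assms(2) by blast
    with cone.inn_neq_org facet_subset[OF F(1)] show False by (metis subsetD)
  next
    assume "{x. y x \<noteq> 0} \<subseteq> insert (Inr 0) ((\<lambda>v. Inr (\<rho> *\<^sub>R v)) ` F)"
    with w show False by blast
  qed
qed

definition inverse_map :: "('v + 'a \<Rightarrow> real) \<Rightarrow> (('v \<Rightarrow> real) + 'a) set" where
  "inverse_map y =
     (if y (Inr 0) = 0 then proj (Inl (\<lambda>w. cone.flow 1 y (Inl w)))
      else proj (Inr (barycenter (ball.flow 1 (\<lambda>x. y (Inr x))))))"

lemma continuous_proj: "continuous_map unglued cone_space proj"
  by (rule quotient_imp_continuous_map[OF quotient_map_proj])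

lemma continuous_proj_Inl:
  assumes "continuous_map T (realization_space L) h"
  shows "continuous_map T cone_space (\<lambda>x. proj (Inl (h x)))"
  using continuous_map_compose[OF continuous_map_compose[OF assms continuous_map_Inl] continuous_proj]
  by (simp add: comp_def)

lemma continuous_proj_Inr:
  assumes "continuous_map T (top_of_set (polyhedron_of B)) h"
  shows "continuous_map T cone_space (\<lambda>x. proj (Inr (h x)))"
  using continuous_map_compose[OF continuous_map_compose[OF assms continuous_map_Inr] continuous_proj]
  by (simp add: comp_def)

lemma barycenter_in: "u \<in> realization B \<Longrightarrow> barycenter u \<in> polyhedron_of B"
  using ball.barycenter_image by blast

lemma continuous_inverse_map: "continuous_map (realization_space M) cone_space inverse_map"
proof (rule pasting_lemma_closed[where I = "UNIV :: bool set"])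
  \<comment> \<open>Pasting needs closed pieces, and \<open>y (Inr 0) \<noteq> 0\<close> is not a
    closed condition. The second branch is therefore considered on all points without mass on
    \<open>L\<close>; the overlap consists of points supported on inner vertices.\<close>
  let ?C1 = "{y \<in> realization M. y (Inr 0) = 0}" and ?C2 = "{y \<in> realization M. \<forall>w. y (Inl w) = 0}"
  let ?T = "\<lambda>b. if b then ?C1 else ?C2"
  let ?f = "\<lambda>b y. if b then proj (Inl (\<lambda>w. cone.flow 1 y (Inl w)))
                 else proj (Inr (barycenter (ball.flow 1 (\<lambda>x. y (Inr x)))))"
  have coord: "continuous_on A (\<lambda>y. y x :: real)" for A :: "('v + 'a \<Rightarrow> real) set" and x
    by (rule continuous_on_product_then_coordinatewise[OF continuous_on_id])
  have "continuous_on A (\<lambda>u. (\<lambda>(t, u). cone.flow t u) (1, u))" for A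
    by (rule continuous_on_compose2[OF cone.continuous_flow[of A]]) (auto intro!: continuous_intros)
  then have flow_cone: "continuous_on A (cone.flow 1)" for A by simp
  have "continuous_on A (\<lambda>u. (\<lambda>(t, u). ball.flow t u) (1, u))" for A
    by (rule continuous_on_compose2[OF ball.continuous_flow[of A]]) (auto intro!: continuous_intros)
  then have flow_ball: "continuous_on A (ball.flow 1)" for A by simp
  show "closedin (realization_space M) (?T b)" for b
  proof (cases b)
    case True
    have "closed {y :: 'v + 'a \<Rightarrow> real. y (Inr 0) = 0}"
      by (intro closed_Collect_eq coord continuous_intros)
    then have "closedin (top_of_set (realization M)) (realization M \<inter> {y. y (Inr 0) = 0})"
      by (rule closedin_closed_Int)
    with True show ?thesis by (simp add: realization_space_def Int_def)
  next
    case False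
    have "closed {y :: 'v + 'a \<Rightarrow> real. \<forall>w. y (Inl w) = 0}"
      by (intro closed_Collect_all closed_Collect_eq coord continuous_intros)
    then have "closedin (top_of_set (realization M)) (realization M \<inter> {y. \<forall>w. y (Inl w) = 0})"
      by (rule closedin_closed_Int)
    with False show ?thesis by (simp add: realization_space_def Int_def)
  qed
  show "continuous_map (subtopology (realization_space M) (?T b)) cone_space (?f b)" for b
  proof (cases b)
    case True
    have "continuous_on ?C1 (\<lambda>y w. cone.flow 1 y (Inl w))"
      by (rule continuous_on_coordinatewise_then_product)
         (rule continuous_on_product_then_coordinatewise[OF flow_cone])
    moreover have "(\<lambda>w. cone.flow 1 y (Inl w)) \<in> realization L" if "y \<in> ?C1" for y
      using that by (intro base_restrict cone.flow_1_in_base) auto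
    ultimately have "continuous_map (top_of_set ?C1) (realization_space L) (\<lambda>y w. cone.flow 1 y (Inl w))"
      by (auto simp: realization_space_def)
    from continuous_proj_Inl[OF this] True show ?thesis
      by (simp add: realization_space_def subtopology_subtopology Int_def)
  next
    case False
    have lift: "(\<lambda>x. y (Inr x)) \<in> realization B" if "y \<in> ?C2" for y
      using that inner_restrict by blast
    have "continuous_on ?C2 (\<lambda>y x. y (Inr x))"
      by (rule continuous_on_coordinatewise_then_product) (rule coord)
    from continuous_on_compose2[OF flow_ball this subset_UNIV]
    have "continuous_on ?C2 (\<lambda>y. ball.flow 1 (\<lambda>x. y (Inr x)))" .
    from continuous_on_compose2[OF ball.continuous_barycenter this] lift
    have "continuous_on ?C2 (\<lambda>y. barycenter (ball.flow 1 (\<lambda>x. y (Inr x))))"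
      using ball.flow_in by (simp add: image_subset_iff)
    moreover have "barycenter (ball.flow 1 (\<lambda>x. y (Inr x))) \<in> polyhedron_of B" if "y \<in> ?C2" for y
      using lift[OF that] by (intro barycenter_in ball.flow_in) auto
    ultimately have "continuous_map (top_of_set ?C2) (top_of_set (polyhedron_of B))
        (\<lambda>y. barycenter (ball.flow 1 (\<lambda>x. y (Inr x))))"
      by (auto simp: realization_space_def)
    from continuous_proj_Inr[OF this] False show ?thesis
      by (simp add: realization_space_def subtopology_subtopology Int_def)
  qed
  show "?f i y = ?f j y" if "y \<in> topspace (realization_space M) \<inter> ?T i \<inter> ?T j" for i j y
  proof (cases "i = j")
    case False
    then have y: "y \<in> realization M" "y (Inr 0) = 0" "\<And>w. y (Inl w) = 0"
      using that by (auto split: if_splits)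
    show ?thesis
      using proj_flow_prism[OF inner_restrict(1)[OF y(1,3)] y(2)] inner_restrict(2)[OF y(1,3)] by simp
  qed simp
  show "\<exists>j. j \<in> UNIV \<and> y \<in> ?T j \<and> inverse_map y = ?f j y" if "y \<in> topspace (realization_space M)" for y
    using that no_base_mass[of y]
    by (intro exI[of _ "y (Inr 0) = 0"]) (auto simp: inverse_map_def realization_space_def)
qed simp

lemma cone_quotient_map_inverse_map:
  assumes y: "y \<in> realization M"
  shows "cone_quotient_map K g B (inverse_map y) = cone.flow 1 y"
proof (cases "y (Inr 0) = 0")
  case True
  then show ?thesis
    using base_restrict(2)[OF cone.flow_1_in_base[OF y True]]
    by (simp add: inverse_map_def cone_quotient_map_proj unglued_map_def)
next
  case False
  note lift = inner_restrict[OF y no_base_mass[OF y False]]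
  have "ball.flow 1 (\<lambda>x. y (Inr x)) \<in> realization B"
    by (rule ball.flow_in[OF lift(1)]) simp
  then show ?thesis
    using False realization_map_cv_flow[OF lift(1), of 1] lift(2)
    by (simp add: inverse_map_def cone_quotient_map_proj unglued_map_def polyhedron_map_def
        ball.barycentric_coords_barycenter)
qed

lemma inverse_map_boundary:
  assumes l: "l \<in> realization L"
  shows "inverse_map (realization_map Inl l) = proj (Inl l)"
proof -
  have "cone.flow 1 (realization_map Inl l) = realization_map Inl l"
    by (rule cone.flow_base[OF realization_map_Inl_in[OF l]]) simp
  moreover have "realization_map Inl l (Inr 0 :: 'v + 'a) = 0" by (rule realization_map_outside) simp
  ultimately show ?thesis by (simp add: inverse_map_def)
qed

text \<open>With origin mass present, \<open>u\<close> has no outer mass and is recovered exactly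
  from its image under \<open>cv\<close>. Without it, the two branches agree by
  \<open>proj_flow_prism\<close>.\<close>

lemma inverse_map_ball:
  assumes u: "u \<in> realization B"
  shows "inverse_map (realization_map cv u) = proj (Inr (barycenter (ball.flow 1 u)))"
proof -
  have Inr: "realization_map cv u (Inr x) = u x" if "x \<notin> \<Union>K" for x
    using realization_map_apply[of u cv x] that cv_not_outer[OF that] by (auto simp: cv_eq_Inr)
  show ?thesis
  proof (cases "u 0 = 0")
    case True
    with Inr[OF zero_notin] show ?thesis
      by (simp add: inverse_map_def proj_flow_prism[OF u True])
  next
    case False
    obtain F where F: "cone_type F u" using prism_or_cone_type[OF u] prism_type_origin False by blast
    have "realization_map cv u (Inr x) = u x" for x
    proof (cases "x \<in> \<Union>K")
      case True
      have "realization_map cv u (Inr x) = 0"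
        using True by (intro realization_map_outside) (auto simp: cv_eq_Inr)
      with cone_type_outer[OF F True] show ?thesis by simp
    qed (rule Inr)
    with False show ?thesis by (simp add: inverse_map_def)
  qed
qed

section \<open>The two homotopies\<close>

lemma homotopic_simplicial_cone:
  "homotopic_with (\<lambda>_. True) (realization_space M) (realization_space M)
     (cone_quotient_map K g B \<circ> inverse_map) id"
proof -
  have "homotopic_with (\<lambda>_. True) (realization_space M) (realization_space M) (cone.flow 0) (cone.flow 1)"
    unfolding homotopic_with_def realization_space_def
    using cone.continuous_flow cone.flow_in
    by (intro exI[of _ "\<lambda>(t, y). cone.flow t y"]) auto
  then have "homotopic_with (\<lambda>_. True) (realization_space M) (realization_space M)
      id (cone_quotient_map K g B \<circ> inverse_map)"
    by (rule homotopic_with_eq)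
       (auto simp: realization_space_def cone.flow_0 cone_quotient_map_inverse_map)
  then show ?thesis by (rule homotopic_with_symD)
qed

text \<open>The flow of the ball fixes the outer layer at all times, so it glues with the constant
  homotopy on the realization of \<open>L\<close>.\<close>

lemma homotopic_topological_cone:
  "homotopic_with (\<lambda>_. True) cone_space cone_space (inverse_map \<circ> cone_quotient_map K g B) id"
proof -
  define h where "h t = case_sum (\<lambda>l. proj (Inl l))
      (\<lambda>b. proj (Inr (barycenter (ball.flow t (barycentric_coords B b)))))" for t :: real
  have "homotopic_with (\<lambda>_. True) cone_space cone_space id (inverse_map \<circ> cone_quotient_map K g B)"
  proof (rule homotopic_with_adjunction_space[where A = "polyhedron_of K" and f = attach
        and X = "realization_space L" and Y = "top_of_set (polyhedron_of B)" and h = h,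
        folded topological_mapping_cone_def])
    show "polyhedron_of K \<subseteq> topspace (top_of_set (polyhedron_of B))"
      using polyhedron_mono by simp
    show "attach ` polyhedron_of K \<subseteq> topspace (realization_space L)"
      using attach_in by (simp add: realization_space_def)
    let ?I = "top_of_set {0..1::real}"
    show "continuous_map (prod_topology ?I (realization_space L)) cone_space (\<lambda>(t, x). h t (Inl x))"
      using continuous_proj_Inl[OF continuous_map_snd, of ?I]
      by (simp add: h_def case_prod_unfold)
    have "continuous_on ({0..1} \<times> polyhedron_of B) (\<lambda>p. (fst p, barycentric_coords B (snd p)))"
      by (intro continuous_intros continuous_on_compose2[OF ball.continuous_barycentric_coords]) auto
    from continuous_on_compose2[OF ball.continuous_flow[of "realization B"] this]
    have "continuous_on ({0..1} \<times> polyhedron_of B)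
        (\<lambda>p. ball.flow (fst p) (barycentric_coords B (snd p)))"
      using ball.barycentric_coords_in by (auto simp: image_subset_iff)
    from continuous_on_compose2[OF ball.continuous_barycenter this]
    have "continuous_on ({0..1} \<times> polyhedron_of B)
        (\<lambda>p. barycenter (ball.flow (fst p) (barycentric_coords B (snd p))))"
      using ball.barycentric_coords_in ball.flow_in by (auto simp: image_subset_iff)
    then have "continuous_map (prod_topology ?I (top_of_set (polyhedron_of B)))
        (top_of_set (polyhedron_of B)) (\<lambda>p. barycenter (ball.flow (fst p) (barycentric_coords B (snd p))))"
      using ball.barycentric_coords_in ball.flow_in barycenter_in by auto
    from continuous_proj_Inr[OF this]
    show "continuous_map (prod_topology ?I (top_of_set (polyhedron_of B))) cone_space (\<lambda>(t, y). h t (Inr y))"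
      by (simp add: h_def case_prod_unfold)
    show "h t (Inr a) = h t (Inl (attach a))" if "t \<in> {0..1}" "a \<in> polyhedron_of K" for t a
    proof -
      have "barycentric_coords B a \<in> realization K"
        using boundary.barycentric_coords_in that(2) by (simp add: barycentric_coords_boundary)
      then have "ball.flow t (barycentric_coords B a) = barycentric_coords B a"
        using that(1) by (intro ball.flow_base) auto
      moreover have "barycenter (barycentric_coords B a) = a"
        using that(2) polyhedron_mono ball.barycenter_barycentric_coords by auto
      ultimately show ?thesis using glue_eq[OF that(2)] by (simp add: h_def)
    qed
    show "id (proj x) = h 0 x" if "x \<in> topspace unglued" for x
      using that ball.flow_0 ball.barycentric_coords_in ball.barycenter_barycentric_coords
      by (auto simp: h_def)
    show "(inverse_map \<circ> cone_quotient_map K g B) (proj x) = h 1 x" if "x \<in> topspace unglued" for x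
      using that inverse_map_boundary inverse_map_ball ball.barycentric_coords_in
      by (auto simp: h_def cone_quotient_map_proj unglued_map_def polyhedron_map_def realization_space_def)
  qed
  then show ?thesis by (rule homotopic_with_symD)
qed

lemma homotopy_equivalence:
  "homotopy_equivalence_map cone_space (realization_space M) (cone_quotient_map K g B)"
  unfolding homotopy_equivalence_map_def
  using continuous_cone_quotient_map continuous_inverse_map homotopic_topological_cone
    homotopic_simplicial_cone
  by blast

end

theorem proposition7:
  fixes d :: nat
    and K :: "'a::euclidean_space set set"
    and L :: "'v set set"
    and g :: "'a \<Rightarrow> 'v"
    and \<rho> :: real
    and R :: "('a \<times> 'a) set"
  assumes "admissible_triangulation d K"
    and "finite_simplicial_complex L"
    and "simplicial_map K L g"
    and "0 < \<rho>" and "\<rho> < 1"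
    and "facet_acyclic_orientation K R"
  shows "homotopy_equivalence_map
           (topological_mapping_cone L K g (simplicial_ball \<rho> R K))
           (realization_space (simplicial_mapping_cone L K g (simplicial_ball \<rho> R K)))
           (cone_quotient_map K g (simplicial_ball \<rho> R K))"
proof -
  have "fan_map K \<rho> R L g"
    using admissible_simplicial_fan[OF assms(1)] assms(2-)
    by (simp add: fan_map_def oriented_fan_def oriented_fan_axioms_def fan_map_axioms_def)
  then show ?thesis by (rule fan_map.homotopy_equivalence)
qed

end
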